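(* Let $\alpha,\beta,v\in\mathbb R$ with $|\alpha-\beta|<|v|<\alpha+\beta+2$, and let $$W(x)=(1-x)^\alpha(1+x)^\beta\Big(W_2\tfrac{(1-x)^2}{4}+W_1\tfrac{1-x}{2}+W_0\Big),\qquad x\in(-1,1),$$ where $$W_2=\begin{pmatrix}\frac{v(v+2+\alpha+\beta)}{v+\alpha-\beta}&0\\0&\frac{v(-v+2+\alpha+\beta)}{v-\alpha+\beta}\end{pmatrix},\quad W_1=\begin{pmatrix}-(v+\alpha+\beta+2)&\alpha+\beta+2\\\alpha+\beta+2&-(-v+\alpha+\beta+2)\end{pmatrix},\quad W_0=\begin{pmatrix}\alpha+1&-\alpha-1\\-\alpha-1&\alpha+1\end{pmatrix}.$$ Then $W$ is a Darboux transformation of the diagonal weight $\tilde W(x)=(1-x)^{\alpha+1}(1+x)^{\beta+1}I$ (with $I$ the $2\times2$ identity matrix).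
   Context: A weight matrix $W$ of size $N$ on an interval is a smooth $\operatorname{Mat}_N(\mathbb C)$-valued function, positive definite almost everywhere, with finite moments of all orders; $\{P_n\}$ denotes the unique sequence of monic matrix polynomials orthogonal for $\langle P,Q\rangle_W=\int P(x)W(x)Q(x)^*dx$. $\operatorname{Mat}_N(\Omega[x])$ is the algebra of matrix differential operators $D=\sum_{j=0}^m\partial^jF_j(x)$, $F_j\in\operatorname{Mat}_N(\mathbb C[x])$, acting on the right: $P\cdot D=\sum_j\partial^j(P)(x)F_j(x)$; products satisfy $P\cdot(D_1D_2)=(P\cdot D_1)\cdot D_2$. $\mathcal D(W)=\{D\in\operatorname{Mat}_N(\Omega[x]):\text{for all }n\ge0,\ P_n\cdot D=\Lambda_n(D)P_n\text{ for some }\Lambda_n(D)\in\operatorname{Mat}_N(\mathbb C)\}$. An operator $\mathcal V\in\operatorname{Mat}_N(\Omega[x])$ is degree-preserving if $\deg(P\cdot\mathcal V)=\deg P$ for all $P\in\operatorname{Mat}_N(\mathbb C[x])$. For weights $U_1,U_2$ of size $N$ on the same interval with monic orthogonal polynomials $P_n^{(1)},P_n^{(2)}$, $U_2$ is a Darboux transformation of $U_1$ if there is $D\in\mathcal D(U_1)$ that factors as $D=\mathcal V\mathcal N$ with $\mathcal V,\mathcal N\in\operatorname{Mat}_N(\Omega[x])$ degree-preserving and $P_n^{(1)}\cdot\mathcal V=A_nP_n^{(2)}$ for all $n\in\mathbb N_0$, for some $A_n\in\operatorname{Mat}_N(\mathbb C)$. *)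

theory Defs
  imports "HOL-Analysis.Analysis" "HOL-Computational_Algebra.Polynomial"
begin

type_synonym 'n mat_poly = "complex poly ^ 'n ^ 'n"

definition mconst :: "complex ^ 'n ^ 'n \<Rightarrow> 'n::finite mat_poly" where
  "mconst A = map_matrix (\<lambda>c. [:c:]) A"

definition mcoeff :: "'n::finite mat_poly \<Rightarrow> nat \<Rightarrow> complex ^ 'n ^ 'n" where
  "mcoeff P k = map_matrix (\<lambda>p. coeff p k) P"

definition meval :: "'n::finite mat_poly \<Rightarrow> real \<Rightarrow> complex ^ 'n ^ 'n" where
  "meval P x = map_matrix (\<lambda>p. poly p (complex_of_real x)) P"

definition mderiv :: "'n::finite mat_poly \<Rightarrow> 'n mat_poly" where
  "mderiv P = map_matrix pderiv P"

text \<open>The zero polynomial must not have the degree of a nonzero constant;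
  the value \<open>-1\<close> plays the role of \<open>-\<infinity>\<close>.\<close>

definition mdegree :: "'n::finite mat_poly \<Rightarrow> int" where
  "mdegree P = (if P = 0 then -1 else int (Max {degree (P $ i $ j) | i j. True}))"

definition monic_of_degree :: "nat \<Rightarrow> 'n::finite mat_poly \<Rightarrow> bool" where
  "monic_of_degree n P \<longleftrightarrow> mcoeff P n = mat 1 \<and> (\<forall>k>n. mcoeff P k = 0)"

definition conj_transpose :: "complex ^ 'n ^ 'm \<Rightarrow> complex ^ 'm ^ 'n" where
  "conj_transpose A = (\<chi> i j. cnj (A $ j $ i))"

definition pos_definite :: "complex ^ 'n ^ 'n \<Rightarrow> bool" where
  "pos_definite A \<longleftrightarrow> conj_transpose A = A \<and>
     (\<forall>z. z \<noteq> 0 \<longrightarrow> 0 < Re (\<Sum>i\<in>UNIV. \<Sum>j\<in>UNIV. cnj (z $ i) * A $ i $ j * z $ j))"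

text \<open>\<open>F k\<close> is the \<open>k\<close>-th derivative, one-sided at an endpoint belonging to \<open>S\<close>.\<close>

definition smooth_on :: "real set \<Rightarrow> (real \<Rightarrow> 'a::real_normed_vector) \<Rightarrow> bool" where
  "smooth_on S f \<longleftrightarrow> (\<exists>F :: nat \<Rightarrow> real \<Rightarrow> 'a. (\<forall>x\<in>S. F 0 x = f x) \<and>
     (\<forall>k. \<forall>x\<in>S. (F k has_vector_derivative F (Suc k) x) (at x within S)))"

definition weight_matrix :: "real set \<Rightarrow> (real \<Rightarrow> complex ^ 'n ^ 'n) \<Rightarrow> bool" where
  "weight_matrix S W \<longleftrightarrow>
     is_interval S \<and> interior S \<noteq> {} \<and>
     smooth_on S W \<and>
     (AE x in lborel. x \<in> S \<longrightarrow> pos_definite (W x)) \<and>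
     (\<forall>k. set_integrable lborel S (\<lambda>x. x ^ k *\<^sub>R W x))"

definition mat_inner ::
  "real set \<Rightarrow> (real \<Rightarrow> complex ^ 'n ^ 'n) \<Rightarrow> 'n::finite mat_poly \<Rightarrow> 'n mat_poly \<Rightarrow> complex ^ 'n ^ 'n"
  where
  "mat_inner S W P Q = (LINT x:S|lborel. meval P x ** W x ** conj_transpose (meval Q x))"

definition is_monic_OP ::
  "real set \<Rightarrow> (real \<Rightarrow> complex ^ 'n ^ 'n) \<Rightarrow> (nat \<Rightarrow> 'n::finite mat_poly) \<Rightarrow> bool" where
  "is_monic_OP S W P \<longleftrightarrow>
     (\<forall>n. monic_of_degree n (P n)) \<and> (\<forall>m n. m \<noteq> n \<longrightarrow> mat_inner S W (P m) (P n) = 0)"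

definition monic_OP ::
  "real set \<Rightarrow> (real \<Rightarrow> complex ^ 'n ^ 'n) \<Rightarrow> nat \<Rightarrow> 'n::finite mat_poly" where
  "monic_OP S W = (THE P. is_monic_OP S W P)"

text \<open>The operator \<open>D = (\<Sum>j. \<partial>^j F\<^sub>j)\<close> is represented by its finitely supported coefficient
  sequence, \<open>F\<^sub>j = coeff D j\<close>.  The type \<open>poly\<close> serves only as a container: composition of
  operators is \<open>dmult\<close> below, not the multiplication of \<open>poly\<close>.\<close>

type_synonym 'n mdiffop = "(complex poly ^ 'n ^ 'n) poly"

definition dact :: "'n::finite mat_poly \<Rightarrow> 'n mdiffop \<Rightarrow> 'n mat_poly" where
  "dact P D = (\<Sum>j\<le>degree D. (mderiv ^^ j) P ** coeff D j)"

text \<open>By the Leibniz rule,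
  \<open>(\<partial>^i F) (\<partial>^j G) = (\<Sum>k\<le>j. \<partial>^(i+k) (binom(j,k) F^(j-k) G))\<close> for operators acting on the right;
  see \<open>dact_dmult\<close>.\<close>

definition dmult :: "'n::finite mdiffop \<Rightarrow> 'n mdiffop \<Rightarrow> 'n mdiffop" where
  "dmult D E = (\<Sum>i\<le>degree D. \<Sum>j\<le>degree E. \<Sum>k\<le>j.
     monom (map_matrix (smult (of_nat (j choose k))) ((mderiv ^^ (j - k)) (coeff D i) ** coeff E j))
       (i + k))"

definition bispectral_alg :: "real set \<Rightarrow> (real \<Rightarrow> complex ^ 'n ^ 'n) \<Rightarrow> 'n::finite mdiffop set" where
  "bispectral_alg S W =
     {D. \<forall>n. \<exists>L. dact (monic_OP S W n) D = mconst L ** monic_OP S W n}"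

definition degree_preserving :: "'n::finite mdiffop \<Rightarrow> bool" where
  "degree_preserving V \<longleftrightarrow> (\<forall>P. mdegree (dact P V) = mdegree P)"

text \<open>Argument order: \<open>U2\<close> is a Darboux transformation of \<open>U1\<close>, so that the operator \<open>D\<close> comes
  from the algebra of \<open>U1\<close>.\<close>

definition is_Darboux_transformation_of ::
  "real set \<Rightarrow> (real \<Rightarrow> complex ^ 'n ^ 'n) \<Rightarrow> (real \<Rightarrow> complex ^ 'n ^ 'n) \<Rightarrow> bool" where
  "is_Darboux_transformation_of S U2 U1 \<longleftrightarrow>
     weight_matrix S U1 \<and> weight_matrix S U2 \<and>
     (\<exists>D \<in> bispectral_alg S U1. \<exists>V N.
        D = dmult V N \<and> degree_preserving V \<and> degree_preserving N \<and>
        (\<forall>n. \<exists>A. dact (monic_OP S U1 n) V = mconst A ** monic_OP S U2 n))"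

lemma mderiv_0: "mderiv 0 = 0"
  by (simp add: mderiv_def vec_eq_iff)

lemma mderiv_add: "mderiv (P + Q) = mderiv P + mderiv Q"
  by (simp add: mderiv_def vec_eq_iff pderiv_add)

lemma mderiv_pow_0: "(mderiv ^^ k) 0 = 0"
  by (induction k) (simp_all add: mderiv_0)

lemma mderiv_pow_add: "(mderiv ^^ k) (P + Q) = (mderiv ^^ k) P + (mderiv ^^ k) Q"
  by (induction k) (simp_all add: mderiv_add)

lemma mderiv_pow_sum: "(mderiv ^^ k) (\<Sum>i\<in>A. f i) = (\<Sum>i\<in>A. (mderiv ^^ k) (f i))"
  by (induction A rule: infinite_finite_induct) (simp_all add: mderiv_pow_0 mderiv_pow_add)

lemma pderiv_sum_set: "pderiv (\<Sum>i\<in>A. f i) = (\<Sum>i\<in>A. pderiv (f i :: complex poly))"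
  by (induction A rule: infinite_finite_induct) (simp_all add: pderiv_add)

lemma pderiv_funpow_mult:
  fixes p q :: "complex poly"
  shows "(pderiv ^^ n) (p * q) =
    (\<Sum>k\<le>n. smult (of_nat (n choose k)) ((pderiv ^^ k) p * (pderiv ^^ (n - k)) q))"
proof (induction n)
  case 0
  then show ?case by simp
next
  case (Suc n)
  define t where "t k m = (pderiv ^^ k) p * (pderiv ^^ m) q" for k m
  have dt: "pderiv (t k m) = t (Suc k) m + t k (Suc m)" for k m
    by (simp add: t_def pderiv_mult mult.commute)
  have "(pderiv ^^ Suc n) (p * q) = (\<Sum>k\<le>n. smult (of_nat (n choose k)) (pderiv (t k (n - k))))"
    by (simp add: Suc.IH pderiv_smult t_def pderiv_sum_set)
  also have "\<dots> = (\<Sum>k\<le>n. smult (of_nat (n choose k)) (t (Suc k) (n - k)))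
      + (\<Sum>k\<le>n. smult (of_nat (n choose k)) (t k (Suc n - k)))"
    by (simp add: dt smult_add_right sum.distrib Suc_diff_le)
  also have "(\<Sum>k\<le>n. smult (of_nat (n choose k)) (t k (Suc n - k)))
      = (\<Sum>k\<le>Suc n. smult (of_nat (n choose k)) (t k (Suc n - k)))"
    by (simp add: binomial_eq_0)
  also have "\<dots> = t 0 (Suc n) + (\<Sum>k\<le>n. smult (of_nat (n choose Suc k)) (t (Suc k) (n - k)))"
    by (subst sum.atMost_Suc_shift) simp
  also have "(\<Sum>k\<le>n. smult (of_nat (n choose k)) (t (Suc k) (n - k))) +
      (t 0 (Suc n) + (\<Sum>k\<le>n. smult (of_nat (n choose Suc k)) (t (Suc k) (n - k))))
    = t 0 (Suc n) + (\<Sum>k\<le>n. smult (of_nat (Suc n choose Suc k)) (t (Suc k) (n - k)))"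
    by (simp add: smult_add_left sum.distrib algebra_simps)
  also have "\<dots> = (\<Sum>k\<le>Suc n. smult (of_nat (Suc n choose k)) (t k (Suc n - k)))"
    by (subst sum.atMost_Suc_shift) simp
  finally show ?case by (simp add: t_def)
qed

lemma mderiv_pow_nth: "(mderiv ^^ k) P $ i $ j = (pderiv ^^ k) (P $ i $ j)"
  by (induction k arbitrary: i j) (simp_all add: mderiv_def)

lemma smult_sum_right: "smult c (\<Sum>i\<in>A. f i) = (\<Sum>i\<in>A. smult c (f i))"
  by (induction A rule: infinite_finite_induct) (simp_all add: smult_add_right)

lemma mderiv_pow_matmul:
  "(mderiv ^^ n) (P ** Q) =
    (\<Sum>k\<le>n. map_matrix (smult (of_nat (n choose k))) ((mderiv ^^ k) P ** (mderiv ^^ (n - k)) Q))"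
proof -
  have "(mderiv ^^ n) (P ** Q) $ i $ j =
    (\<Sum>k\<le>n. map_matrix (smult (of_nat (n choose k)))
      ((mderiv ^^ k) P ** (mderiv ^^ (n - k)) Q)) $ i $ j" for i j
  proof -
    have "(mderiv ^^ n) (P ** Q) $ i $ j =
      (\<Sum>l\<in>UNIV. \<Sum>k\<le>n. smult (of_nat (n choose k))
         ((pderiv ^^ k) (P $ i $ l) * (pderiv ^^ (n - k)) (Q $ l $ j)))"
      by (simp add: mderiv_pow_nth matrix_matrix_mult_def higher_pderiv_sum pderiv_funpow_mult)
    then show ?thesis
      by (subst (asm) sum.swap)
        (simp add: mderiv_pow_nth matrix_matrix_mult_def smult_sum_right)
  qed
  then show ?thesis by (simp add: vec_eq_iff)
qed

lemma matmul_0_right: "(P :: 'n::finite mat_poly) ** 0 = 0"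
  by (simp add: vec_eq_iff matrix_matrix_mult_def)

lemma matmul_0_left: "0 ** (P :: 'n::finite mat_poly) = 0"
  by (simp add: vec_eq_iff matrix_matrix_mult_def)

lemma matmul_add_left: "(P + Q) ** (R :: 'n::finite mat_poly) = P ** R + Q ** R"
  by (simp add: vec_eq_iff matrix_matrix_mult_def distrib_right sum.distrib)

lemma matmul_sum_left: "(\<Sum>i\<in>A. f i) ** (P :: 'n::finite mat_poly) = (\<Sum>i\<in>A. f i ** P)"
  by (induction A rule: infinite_finite_induct)
    (simp_all add: matmul_0_left matmul_add_left)

lemma matmul_smult:
  "(A :: 'n::finite mat_poly) ** map_matrix (smult c) B = map_matrix (smult c) (A ** B)"
  "map_matrix (smult c) A ** B = map_matrix (smult c) (A ** (B :: 'n::finite mat_poly))"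
  by (simp_all add: vec_eq_iff matrix_matrix_mult_def smult_sum_right)

lemma dact_eq:
  assumes "degree D \<le> n"
  shows "dact P D = (\<Sum>j\<le>n. (mderiv ^^ j) P ** coeff D j)"
  unfolding dact_def using assms
  by (intro sum.mono_neutral_left) (auto simp: coeff_eq_0 matmul_0_right)

lemma dact_0: "dact P 0 = 0"
  by (simp add: dact_def matmul_0_right)

lemma dact_add: "dact P (D + E) = dact P D + dact P E"
proof -
  let ?n = "max (degree D) (degree E)"
  have "degree (D + E) \<le> ?n" by (rule degree_add_le) auto
  then show ?thesis
    by (simp add: dact_eq[of _ ?n] matrix_add_ldistrib sum.distrib)
qed

lemma dact_sum: "dact P (\<Sum>i\<in>A. f i) = (\<Sum>i\<in>A. dact P (f i))"
  by (induction A rule: infinite_finite_induct) (simp_all add: dact_0 dact_add)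

lemma dact_monom: "dact P (monom F k) = (mderiv ^^ k) P ** F"
proof -
  have "dact P (monom F k) = (\<Sum>j\<le>k. (mderiv ^^ j) P ** coeff (monom F k) j)"
    by (rule dact_eq) (rule degree_monom_le)
  also have "\<dots> = (\<Sum>j\<le>k. if j = k then (mderiv ^^ k) P ** F else 0)"
    by (intro sum.cong) (auto simp: matmul_0_right)
  finally show ?thesis by simp
qed

lemma dact_dmult: "dact P (dmult D E) = dact (dact P D) E"
proof -
  have "dact (dact P D) E =
      (\<Sum>j\<le>degree E. \<Sum>i\<le>degree D. \<Sum>k\<le>j. map_matrix (smult (of_nat (j choose k)))
         ((mderiv ^^ (i + k)) P ** ((mderiv ^^ (j - k)) (coeff D i) ** coeff E j)))"
    by (simp add: dact_def mderiv_pow_sum matmul_sum_left mderiv_pow_matmul matmul_smult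
        matrix_mul_assoc add.commute flip: funpow_add[THEN fun_cong, unfolded o_def])
  also have "\<dots> = dact P (dmult D E)"
    by (subst sum.swap) (simp add: dmult_def dact_sum dact_monom matmul_smult)
  finally show ?thesis ..
qed

end

theory Submission
  imports Defs
begin

text \<open>
  Write \<open>W = (1 - x)\<^sup>\<alpha> (1 + x)\<^sup>\<beta> M\<close> with a quadratic matrix polynomial \<open>M\<close>, and let
  \<open>w = (1 - x)\<^sup>\<alpha>\<^sup>+\<^sup>1 (1 + x)\<^sup>\<beta>\<^sup>+\<^sup>1\<close> be the scalar weight on the diagonal of \<open>Wt\<close>.
  The determinant of \<open>M\<close> is a positive constant times \<open>(1 - x\<^sup>2)\<^sup>2\<close>, and \<open>M\<close> drops to rank one at
  both endpoints.  A linear polynomial \<open>V1\<close> whose values at \<open>1\<close> and \<open>-1\<close> lie in the left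
  kernels of \<open>M\<close> there makes \<open>V1 W\<close> equal to \<open>w\<close> times a polynomial.  This is exactly what
  is needed for an operator \<open>V = \<partial> V1 + V0\<close> to have, after one integration by parts
  (\<open>first_order_adjoint\<close>), an adjoint \<open>N = \<partial> N1 + N0\<close> with polynomial coefficients:
  the inner product of \<open>P \<cdot> V\<close> with \<open>Q\<close> for \<open>W\<close> is that of \<open>P\<close> with \<open>Q \<cdot> N\<close> for \<open>Wt\<close>.
  The two polynomial identities behind this are \<open>V1_mult_W_poly\<close> and \<open>V0_mult_W_poly\<close>; the
  boundary terms vanish since \<open>w\<close> does, as \<open>\<alpha>, \<beta> > -1\<close>.

  Such an adjoint pair of degree-preserving operators always gives a Darboux transformation
  (\<open>Darboux_of_adjoint_pair\<close>).  Indeed \<open>P\<^sub>n \<cdot> V\<close> has degree at most \<open>n\<close> and is orthogonal for \<open>W\<close>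
  to everything of lower degree, so it is \<open>A\<^sub>n Q\<^sub>n\<close> for the monic orthogonal polynomial
  \<open>Q\<^sub>n\<close> of \<open>W\<close>; likewise \<open>Q\<^sub>n \<cdot> N = B\<^sub>n P\<^sub>n\<close>, and \<open>P\<^sub>n\<close> is an eigenfunction of \<open>V N\<close>
  with eigenvalue \<open>A\<^sub>n B\<^sub>n\<close>.  Degree preservation comes from the invertibility of
  \<open>n V1' + V0\<close> and \<open>n N1' + N0\<close>, where \<open>\<bar>v\<bar> < \<alpha> + \<beta> + 2\<close> enters.

  The argument uses that a weight matrix has exactly one sequence of monic orthogonal polynomials
  (\<open>is_monic_OP_monic_OP\<close>), which rests on the definiteness of the matrix inner product
  (\<open>mat_inner_definite\<close>).
\<close>

section \<open>Matrix polynomials\<close>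

lemmas scaleR_complex = scaleR_conv_of_real[where 'a = complex]

lemma mat_poly_eqI: "(\<And>k. mcoeff P k = mcoeff Q k) \<Longrightarrow> P = Q"
  by (simp add: mcoeff_def vec_eq_iff poly_eq_iff)

lemma mcoeff_nth [simp]: "mcoeff P k $ i $ j = coeff (P $ i $ j) k"
  by (simp add: mcoeff_def)

lemma mcoeff_0 [simp]: "mcoeff 0 k = 0"
  by (simp add: vec_eq_iff)

lemma mcoeff_add [simp]: "mcoeff (P + Q) k = mcoeff P k + mcoeff Q k"
  by (simp add: vec_eq_iff)

lemma mcoeff_diff [simp]: "mcoeff (P - Q) k = mcoeff P k - mcoeff Q k"
  by (simp add: vec_eq_iff)

lemma mcoeff_sum [simp]: "mcoeff (\<Sum>i\<in>A. f i) k = (\<Sum>i\<in>A. mcoeff (f i) k)"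
  by (induction A rule: infinite_finite_induct) simp_all

lemma mcoeff_mconst_mult [simp]: "mcoeff (mconst A ** P) k = A ** mcoeff P k"
  by (simp add: vec_eq_iff matrix_matrix_mult_def mconst_def coeff_sum)

lemma mcoeff_mderiv: "mcoeff (mderiv P) k = real (Suc k) *\<^sub>R mcoeff P (Suc k)"
  by (simp add: vec_eq_iff mderiv_def coeff_pderiv scaleR_complex del: of_nat_Suc)

lemma mcoeff_eventually_0: "\<exists>N. \<forall>k>N. mcoeff P k = 0"
proof -
  have "\<forall>k>Max (range (\<lambda>(i, j). degree (P $ i $ j))). mcoeff P k = 0"
    by (auto simp: vec_eq_iff coeff_eq_0 Max_less_iff)
  then show ?thesis by blast
qed

text \<open>A product with a linear factor is what an operator of order one that does not raise the degree
  produces: its coefficients have degree at most one.\<close>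

lemma mcoeff_linear_mult:
  assumes "\<And>k. k > 1 \<Longrightarrow> mcoeff F k = 0"
  shows "mcoeff (P ** F) (Suc k) = mcoeff P (Suc k) ** mcoeff F 0 + mcoeff P k ** mcoeff F 1"
    and "mcoeff (P ** F) 0 = mcoeff P 0 ** mcoeff F 0"
proof -
  have F: "F $ i $ j = [:coeff (F $ i $ j) 0, coeff (F $ i $ j) 1:]" for i j
  proof (rule poly_eqI)
    fix k
    have "coeff (F $ i $ j) k = 0" if "k > 1"
      using assms[OF that] by (metis mcoeff_nth zero_index)
    then show "coeff (F $ i $ j) k = coeff [:coeff (F $ i $ j) 0, coeff (F $ i $ j) 1:] k"
      by (auto simp: coeff_pCons split: nat.splits)
  qed
  have m: "coeff (p * [:c, d:]) (Suc k) = coeff p (Suc k) * c + coeff p k * d"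
    "coeff (p * [:c, d:]) 0 = coeff p 0 * c" for p :: "complex poly" and c d k
    by (simp_all add: mult.commute[of p] algebra_simps)
  show "mcoeff (P ** F) (Suc k) = mcoeff P (Suc k) ** mcoeff F 0 + mcoeff P k ** mcoeff F 1"
    by (simp add: vec_eq_iff matrix_matrix_mult_def coeff_sum sum.distrib[symmetric])
       (intro allI sum.cong refl, subst (1) F, simp add: m)
  show "mcoeff (P ** F) 0 = mcoeff P 0 ** mcoeff F 0"
    by (simp add: vec_eq_iff matrix_matrix_mult_def coeff_mult_0 coeff_sum)
qed

lemma mdegree_eq:
  assumes "mcoeff P n \<noteq> 0" "\<And>k. k > n \<Longrightarrow> mcoeff P k = 0"
  shows "mdegree P = int n"
proof -
  have deg: "degree (P $ i $ j) \<le> n" for i j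
  proof (rule degree_le, intro allI impI)
    fix k assume "n < k"
    then show "coeff (P $ i $ j) k = 0"
      using assms(2)[of k] by (metis mcoeff_nth zero_index)
  qed
  obtain i j where "coeff (P $ i $ j) n \<noteq> 0"
    using assms(1) by (auto simp: vec_eq_iff)
  then have "degree (P $ i $ j) = n"
    using deg[of i j] le_degree[of "P $ i $ j" n] by simp
  moreover have "finite {degree (P $ i $ j) | i j. True}"
    by (rule finite_subset[of _ "{..n}"]) (use deg in auto)
  ultimately have "Max {degree (P $ i $ j) | i j. True} = n"
    by (intro Max_eqI) (use deg in auto)
  moreover have "P \<noteq> 0" using assms(1) by auto
  ultimately show ?thesis by (simp add: mdegree_def)
qed

lemma mat_poly_degree_cases:
  obtains "P = 0" | n where "mcoeff P n \<noteq> 0" "\<And>k. k > n \<Longrightarrow> mcoeff P k = 0"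
proof (cases "P = 0")
  case False
  define S where "S = {k. mcoeff P k \<noteq> 0}"
  have "S \<noteq> {}" using False mat_poly_eqI[of P 0] by (auto simp: S_def)
  moreover obtain N where "\<forall>k>N. mcoeff P k = 0" using mcoeff_eventually_0 by blast
  then have "finite S" by (intro finite_subset[of S "{..N}"]) (auto simp: S_def not_less[symmetric])
  ultimately have "Max S \<in> S" "\<And>k. k > Max S \<Longrightarrow> k \<notin> S"
    by (simp, metis Max_ge leD)
  then show ?thesis unfolding S_def by (intro that(2)) blast+
qed (rule that)

lemma mdegree_less_iff: "mdegree P < int n \<longleftrightarrow> (\<forall>k\<ge>n. mcoeff P k = 0)"
proof (cases P rule: mat_poly_degree_cases)
  case 1
  then show ?thesis by (simp add: mdegree_def)
next
  case (2 m)
  then show ?thesis using mdegree_eq[of P m]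
    by (metis leD leI le_less_trans nat_less_le of_nat_less_iff)
qed

lemma meval_nth [simp]: "meval P x $ i $ j = poly (P $ i $ j) (complex_of_real x)"
  by (simp add: meval_def)

lemma meval_add [simp]: "meval (P + Q) x = meval P x + meval Q x"
  by (simp add: vec_eq_iff)

lemma meval_mult [simp]: "meval (P ** Q) x = meval P x ** meval Q x"
  by (simp add: vec_eq_iff matrix_matrix_mult_def poly_sum)

lemma meval_mconst [simp]: "meval (mconst A) x = A"
  by (simp add: vec_eq_iff mconst_def)

lemma meval_eq_sum: "\<exists>N. \<forall>x. meval P x = (\<Sum>k\<le>N. x ^ k *\<^sub>R mcoeff P k)"
proof -
  obtain N where N: "\<forall>k>N. mcoeff P k = 0" using mcoeff_eventually_0 by blast
  have "degree (P $ i $ j) \<le> N" for i j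
    by (rule degree_le) (metis N mcoeff_nth zero_index)
  then have "poly (P $ i $ j) x = (\<Sum>k\<le>N. coeff (P $ i $ j) k * x ^ k)" for i j x
    unfolding poly_altdef
    by (intro sum.mono_neutral_left) (auto simp: coeff_eq_0)
  then have "meval P x = (\<Sum>k\<le>N. x ^ k *\<^sub>R mcoeff P k)" for x
    unfolding vec_eq_iff by (simp add: scaleR_complex mult.commute)
  then show ?thesis by blast
qed

section \<open>Matrix algebra over the complex numbers\<close>

lemma conj_transpose_nth [simp]: "conj_transpose A $ i $ j = cnj (A $ j $ i)"
  by (simp add: conj_transpose_def)

lemma conj_transpose_mult: "conj_transpose (A ** B) = conj_transpose B ** conj_transpose A"
  by (simp add: vec_eq_iff matrix_matrix_mult_def mult.commute)

lemma conj_transpose_conj_transpose [simp]: "conj_transpose (conj_transpose A) = A"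
  by (simp add: vec_eq_iff)

lemma bounded_linear_conj_transpose: "bounded_linear (conj_transpose :: complex^'n^'m \<Rightarrow> _)"
  by (intro linear_conv_bounded_linear[THEN iffD1] linearI) (simp_all add: vec_eq_iff)

lemma matrix_add_rdistrib: "((A + B) ** C :: 'a::semiring_1^'k^'m) = A ** C + B ** C"
  by (simp add: vec_eq_iff matrix_matrix_mult_def distrib_right sum.distrib)

lemma bounded_bilinear_matrix_mult:
  "bounded_bilinear ((**) :: complex^'n^'m \<Rightarrow> complex^'k^'n \<Rightarrow> complex^'k^'m)"
  unfolding bilinear_conv_bounded_bilinear[symmetric] bilinear_def
  by (auto intro!: linearI simp: matrix_add_ldistrib matrix_add_rdistrib)
     (simp_all add: vec_eq_iff matrix_matrix_mult_def scaleR_sum_right)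

lemmas bounded_linear_matrix_mult_left =
  bounded_bilinear.bounded_linear_left[OF bounded_bilinear_matrix_mult]
lemmas bounded_linear_matrix_mult_right =
  bounded_bilinear.bounded_linear_right[OF bounded_bilinear_matrix_mult]
lemmas matrix_mult_zero_left =
  bounded_bilinear.zero_left[OF bounded_bilinear_matrix_mult]
lemmas matrix_mult_zero_right =
  bounded_bilinear.zero_right[OF bounded_bilinear_matrix_mult]

section \<open>The matrix-valued inner product of a weight\<close>

lemma set_integral_bounded_linear:
  assumes "bounded_linear T" "set_integrable M A f"
  shows "set_integrable M A (\<lambda>x. T (f x))"
    and "(LINT x:A|M. T (f x)) = T (LINT x:A|M. f x)"
proof -
  have T: "indicator A x *\<^sub>R T (f x) = T (indicator A x *\<^sub>R f x)" for x
    by (simp add: linear_scale bounded_linear.linear[OF assms(1)])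
  show "set_integrable M A (\<lambda>x. T (f x))"
    using integrable_bounded_linear[OF assms(1), of M "\<lambda>x. indicator A x *\<^sub>R f x"] assms(2)
    by (simp add: set_integrable_def T)
  show "(LINT x:A|M. T (f x)) = T (LINT x:A|M. f x)"
    using integral_bounded_linear[OF assms(1), of M "\<lambda>x. indicator A x *\<^sub>R f x"] assms(2)
    by (simp add: set_integrable_def set_lebesgue_integral_def T)
qed

text \<open>Expanding the two polynomials leaves finitely many constant matrices multiplied on both
  sides of \<open>x\<^sup>k W\<close>, whose integrability is the finiteness of the moments.\<close>

lemma weight_matrix_integrable:
  fixes W :: "real \<Rightarrow> complex^'n^'n"
  assumes "weight_matrix S W"
  shows "set_integrable lborel S (\<lambda>x. meval P x ** W x ** conj_transpose (meval Q x))"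
proof -
  interpret bounded_bilinear "(**) :: complex^'n^'n \<Rightarrow> complex^'n^'n \<Rightarrow> complex^'n^'n"
    by (rule bounded_bilinear_matrix_mult)
  interpret ct: bounded_linear "conj_transpose :: complex^'n^'n \<Rightarrow> complex^'n^'n"
    by (rule bounded_linear_conj_transpose)
  obtain M where M: "\<And>x. meval P x = (\<Sum>k\<le>M. x ^ k *\<^sub>R mcoeff P k)"
    using meval_eq_sum by blast
  obtain N where N: "\<And>x. meval Q x = (\<Sum>k\<le>N. x ^ k *\<^sub>R mcoeff Q k)"
    using meval_eq_sum by blast
  have eq: "meval P x ** W x ** conj_transpose (meval Q x) = (\<Sum>k\<le>M. \<Sum>l\<le>N.
      mcoeff P k ** (x ^ (k + l) *\<^sub>R W x) ** conj_transpose (mcoeff Q l))" for x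
    unfolding M N ct.sum ct.scaleR sum_left sum_right scaleR_left scaleR_right
      scaleR_scaleR power_add
    by (subst sum.swap) (simp add: scaleR_sum_right mult.commute)
  have "set_integrable lborel S (\<lambda>x. x ^ k *\<^sub>R W x)" for k
    using assms by (simp add: weight_matrix_def)
  then have "set_integrable lborel S
      (\<lambda>x. mcoeff P k ** (x ^ (k + l) *\<^sub>R W x) ** conj_transpose (mcoeff Q l))" for k l
    by (intro set_integral_bounded_linear(1)[OF bounded_linear_matrix_mult_left]
        set_integral_bounded_linear(1)[OF bounded_linear_matrix_mult_right])
  then show ?thesis
    unfolding eq set_integrable_def scaleR_sum_right
    by (intro Bochner_Integration.integrable_sum)
qed

lemma mat_inner_add_left:
  assumes "weight_matrix S W"
  shows "mat_inner S W (P + Q) R = mat_inner S W P R + mat_inner S W Q R"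
  using weight_matrix_integrable[OF assms, of P R] weight_matrix_integrable[OF assms, of Q R]
  by (simp add: mat_inner_def matrix_add_rdistrib set_integral_add)

lemma mat_inner_mconst_left:
  assumes "weight_matrix S W"
  shows "mat_inner S W (mconst A ** P) R = A ** mat_inner S W P R"
  using set_integral_bounded_linear(2)[OF bounded_linear_matrix_mult_right
      weight_matrix_integrable[OF assms, of P R], of A]
  by (simp add: mat_inner_def matrix_mul_assoc)

lemma mat_inner_sym:
  assumes "weight_matrix S W"
  shows "mat_inner S W Q P = conj_transpose (mat_inner S W P Q)"
proof -
  have W: "AE x in lborel. x \<in> S \<longrightarrow> conj_transpose (W x) = W x"
    using assms unfolding weight_matrix_def pos_definite_def by (auto elim: eventually_mono)
  have "conj_transpose (mat_inner S W P Q) =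
      (LINT x:S|lborel. conj_transpose (meval P x ** W x ** conj_transpose (meval Q x)))"
    unfolding mat_inner_def
    by (rule set_integral_bounded_linear(2)[OF bounded_linear_conj_transpose
          weight_matrix_integrable[OF assms], symmetric])
  also have "\<dots> = mat_inner S W Q P"
    unfolding mat_inner_def set_lebesgue_integral_def
  proof (rule integral_cong_AE)
    show "(\<lambda>x. indicator S x *\<^sub>R conj_transpose (meval P x ** W x ** conj_transpose (meval Q x)))
        \<in> borel_measurable lborel"
      using set_integral_bounded_linear(1)[OF bounded_linear_conj_transpose
          weight_matrix_integrable[OF assms]] by (auto simp: set_integrable_def)
    show "(\<lambda>x. indicator S x *\<^sub>R (meval Q x ** W x ** conj_transpose (meval P x)))
        \<in> borel_measurable lborel"
      using weight_matrix_integrable[OF assms] by (auto simp: set_integrable_def)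
    show "AE x in lborel. indicator S x *\<^sub>R
        conj_transpose (meval P x ** W x ** conj_transpose (meval Q x)) =
        indicator S x *\<^sub>R (meval Q x ** W x ** conj_transpose (meval P x))"
      using W by eventually_elim (auto simp: indicator_def conj_transpose_mult matrix_mul_assoc)
  qed
  finally show ?thesis ..
qed

lemma mat_inner_zero_sym:
  assumes "weight_matrix S W" "mat_inner S W P Q = 0"
  shows "mat_inner S W Q P = 0"
  using mat_inner_sym[OF assms(1), of Q P] assms(2) by (simp add: vec_eq_iff)

text \<open>The diagonal entries of \<open>mat_inner S W R R\<close> integrate \<open>r W r\<^sup>*\<close> over the rows \<open>r\<close> of \<open>R\<close>.
  If they vanish, each row is zero almost everywhere on \<open>S\<close>; since \<open>S\<close> contains an interval,
  the polynomial entries then have infinitely many roots.\<close>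

lemma mat_inner_definite:
  fixes W :: "real \<Rightarrow> complex^'n^'n"
  assumes W: "weight_matrix S W" and R: "mat_inner S W R R = 0"
  shows "R = 0"
proof -
  define f where "f i x = (meval R x ** W x ** conj_transpose (meval R x)) $ i $ i" for i x
  \<comment> \<open>a quadratic form \<open>z\<^sup>* W z\<close> becomes \<open>r W r\<^sup>*\<close> when \<open>z\<close> is the conjugate of the row \<open>r\<close>\<close>
  define z where "z i x = (\<chi> j. cnj (meval R x $ i $ j))" for i x
  have S: "interior S \<noteq> {}"
    using W by (simp add: weight_matrix_def)
  have blin: "bounded_linear (\<lambda>A::complex^'n^'n. Re (A $ i $ i))" for i
    by (intro bounded_linear_compose[OF bounded_linear_Re] bounded_linear_compose[OF bounded_linear_vec_nth]
        bounded_linear_vec_nth)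
  have f_alt: "f i x = (\<Sum>j\<in>UNIV. \<Sum>k\<in>UNIV. cnj (z i x $ j) * W x $ j $ k * z i x $ k)" for i x
    unfolding f_def z_def matrix_matrix_mult_def
    by (simp add: sum_distrib_right) (rule sum.swap)
  have pos: "AE x in lborel. x \<in> S \<longrightarrow> (z i x \<noteq> 0 \<longrightarrow> Re (f i x) > 0) \<and> Re (f i x) \<ge> 0" for i
  proof -
    have "AE x in lborel. x \<in> S \<longrightarrow> pos_definite (W x)"
      using W by (simp add: weight_matrix_def)
    then show ?thesis
    proof eventually_elim
      case (elim x)
      have "Re (f i x) > 0" if "x \<in> S" "z i x \<noteq> 0"
        using elim that unfolding pos_definite_def f_alt by blast
      moreover have "Re (f i x) \<ge> 0" if "z i x = 0" using that by (simp add: f_alt)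
      ultimately show ?case by (cases "z i x = 0") (auto intro: less_imp_le)
    qed
  qed
  have "R $ i $ j = 0" for i j
  proof -
    have int: "set_integrable lborel S (\<lambda>x. Re (f i x))"
      "(LINT x:S|lborel. Re (f i x)) = 0"
      using set_integral_bounded_linear[OF blin weight_matrix_integrable[OF W, of R R], of i] R
      by (auto simp: f_def mat_inner_def)
    have "AE x in lborel. indicator S x *\<^sub>R Re (f i x) = 0"
    proof (subst integral_nonneg_eq_0_iff_AE[symmetric])
      show "integrable lborel (\<lambda>x. indicator S x *\<^sub>R Re (f i x))"
        using int by (simp add: set_integrable_def)
      show "AE x in lborel. 0 \<le> indicator S x *\<^sub>R Re (f i x)"
        using pos[of i] by eventually_elim (auto simp: indicator_def)
      show "(LINT x|lborel. indicator S x *\<^sub>R Re (f i x)) = 0"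
        using int by (simp add: set_lebesgue_integral_def)
    qed
    with pos[of i] have "AE x in lborel. x \<in> S \<longrightarrow> z i x = 0"
      by eventually_elim (auto simp: indicator_def)
    then have ae: "AE x in lborel. x \<notin> {x \<in> interior S. z i x \<noteq> 0}"
      by eventually_elim (use interior_subset in auto)
    have "interior S \<subseteq> {x. z i x = 0}"
    proof -
      have "continuous_on UNIV (z i)"
        unfolding z_def by (auto intro!: continuous_intros)
      then have "open (interior S \<inter> {x. z i x \<noteq> 0})"
        by (intro open_Int open_interior open_Collect_neq) auto
      moreover from this have "interior S \<inter> {x. z i x \<noteq> 0} \<in> null_sets lborel"
        using ae by (subst AE_iff_null_sets) auto
      then have "negligible (interior S \<inter> {x. z i x \<noteq> 0})"
        by (simp add: negligible_iff_null_sets null_sets_completionI)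
      ultimately show ?thesis using open_not_negligible by blast
    qed
    moreover have "infinite (interior S)"
      using S by (meson open_interior finite_imp_not_open)
    ultimately have "infinite {x. z i x = 0}" by (rule infinite_super)
    then have "infinite (complex_of_real ` {x. z i x = 0})"
      by (simp add: finite_image_iff inj_on_def)
    moreover have "complex_of_real ` {x. z i x = 0} \<subseteq> {w. poly (R $ i $ j) w = 0}"
      by (auto simp: z_def vec_eq_iff)
    ultimately show ?thesis
      using poly_roots_finite[of "R $ i $ j"] infinite_super by blast
  qed
  then show ?thesis by (simp add: vec_eq_iff)
qed

section \<open>Existence and uniqueness of monic orthogonal polynomials\<close>

lemma mat_inner_diff_left:
  assumes "weight_matrix S W"
  shows "mat_inner S W (P - Q) R = mat_inner S W P R - mat_inner S W Q R"
  using mat_inner_add_left[OF assms, of "P - Q" Q R] by simp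

lemma mat_inner_zero_left:
  assumes "weight_matrix S W"
  shows "mat_inner S W 0 R = 0"
  using mat_inner_diff_left[OF assms, of 0 0] by simp

lemma mat_inner_sum_left:
  assumes "weight_matrix S W"
  shows "mat_inner S W (\<Sum>i\<in>I. f i) R = (\<Sum>i\<in>I. mat_inner S W (f i) R)"
  by (induction I rule: infinite_finite_induct)
     (simp_all add: mat_inner_zero_left[OF assms] mat_inner_add_left[OF assms])

text \<open>Monic polynomials of degrees \<open>0, \<dots>, n - 1\<close> generate all matrix polynomials of lower
  degree with left matrix coefficients, so orthogonality need only be tested on them.\<close>

lemma mat_inner_zero_if_orthogonal_to_monics:
  assumes W: "weight_matrix S W"
    and R: "\<And>k. k < n \<Longrightarrow> monic_of_degree k (R k)"
    and orth: "\<And>k. k < n \<Longrightarrow> mat_inner S W (R k) P = 0"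
    and Q: "\<And>k. k \<ge> n \<Longrightarrow> mcoeff Q k = 0"
  shows "mat_inner S W Q P = 0"
  using assms(2-4)
proof (induction n arbitrary: Q)
  case 0
  then have "Q = 0" by (intro mat_poly_eqI) simp
  then show ?case by (simp add: mat_inner_zero_left[OF W])
next
  case (Suc n)
  define T where "T = Q - mconst (mcoeff Q n) ** R n"
  have "mcoeff T k = 0" if "k \<ge> n" for k
    using Suc.prems(1)[of n] Suc.prems(3)[of k] that
    by (cases "k = n")
       (auto simp: T_def monic_of_degree_def matrix_mult_zero_right)
  then have "mat_inner S W T P = 0"
    using Suc by auto
  then show ?case
    using Suc.prems(2)[of n]
    by (simp add: T_def mat_inner_diff_left[OF W] mat_inner_mconst_left[OF W]
        matrix_mult_zero_right)
qed

text \<open>A left annihilator \<open>C\<close> of \<open>mat_inner S W P P\<close> makes \<open>C P\<close> a null vector of the inner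
  product, and \<open>C\<close> is the leading coefficient of \<open>C P\<close>.\<close>

lemma invertible_mat_inner_monic:
  fixes W :: "real \<Rightarrow> complex^'n^'n"
  assumes W: "weight_matrix S W" and P: "monic_of_degree n P"
  shows "invertible (mat_inner S W P P)"
proof -
  let ?M = "mat_inner S W P P"
  have "x = 0" if x: "x v* ?M = 0" for x
  proof -
    define C :: "complex^'n^'n" where "C = (\<chi> i. x)"
    have "C ** ?M = 0"
      using x by (simp add: C_def vec_eq_iff matrix_matrix_mult_def vector_matrix_mult_def mult.commute)
    then have "mat_inner S W (mconst C ** P) P = 0"
      by (simp add: mat_inner_mconst_left[OF W])
    then have "mat_inner S W (mconst C ** P) (mconst C ** P) = 0"
      by (simp add: mat_inner_mconst_left[OF W] mat_inner_zero_sym[OF W]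
        matrix_mult_zero_right)
    then have "mconst C ** P = 0" by (rule mat_inner_definite[OF W])
    then have "mcoeff (mconst C ** P) n = 0" by simp
    then have "C = 0" using P by (simp add: monic_of_degree_def)
    then show "x = 0" by (simp add: C_def vec_eq_iff)
  qed
  then have "x = 0" if "transpose ?M *v x = 0" for x
    using that by simp
  then have "invertible (transpose ?M)"
    by (simp add: invertible_left_inverse matrix_left_invertible_ker)
  then show ?thesis by (simp add: invertible_det_nz det_transpose)
qed

text \<open>Gram-Schmidt orthogonalisation of \<open>x\<^sup>n\<close>.\<close>

lemma ex_monic_orthogonal:
  fixes W :: "real \<Rightarrow> complex^'n^'n"
  assumes W: "weight_matrix S W"
  shows "\<exists>P. monic_of_degree n P \<and> (\<forall>Q. (\<forall>k\<ge>n. mcoeff Q k = 0) \<longrightarrow> mat_inner S W Q P = 0)"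
proof (induction n rule: less_induct)
  case (less n)
  then obtain R where R: "\<And>k. k < n \<Longrightarrow> monic_of_degree k (R k)"
    and orth: "\<And>k Q. k < n \<Longrightarrow> \<forall>i\<ge>k. mcoeff Q i = 0 \<Longrightarrow> mat_inner S W Q (R k) = 0"
    by metis
  have R_orth: "mat_inner S W (R k) (R j) = 0" if "k < n" "j < n" "k \<noteq> j" for j k
  proof (cases "k < j")
    case True
    then show ?thesis using orth[of j "R k"] R[of k] that by (auto simp: monic_of_degree_def)
  next
    case False
    then have "mat_inner S W (R j) (R k) = 0"
      using orth[of k "R j"] R[of j] that by (auto simp: monic_of_degree_def)
    then show ?thesis by (rule mat_inner_zero_sym[OF W])
  qed
  define X :: "'n mat_poly" where "X = map_matrix (\<lambda>c. monom c n) (mat 1)"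
  have "\<exists>G. G ** mat_inner S W (R k) (R k) = mat 1" if "k < n" for k
    using invertible_mat_inner_monic[OF W R[OF that]] by (auto simp: invertible_def)
  then obtain G where G: "\<And>k. k < n \<Longrightarrow> G k ** mat_inner S W (R k) (R k) = mat 1"
    by metis
  define c where "c k = mat_inner S W X (R k) ** G k" for k
  define P where "P = X - (\<Sum>k<n. mconst (c k) ** R k)"
  have "mcoeff X k = (if k = n then mat 1 else 0)" for k
    by (simp add: X_def vec_eq_iff)
  moreover have "mcoeff (\<Sum>k<n. mconst (c k) ** R k) j = 0" if "j \<ge> n" for j
    using R that by (auto simp: monic_of_degree_def
        matrix_mult_zero_right intro!: sum.neutral)
  ultimately have "monic_of_degree n P"
    by (simp add: P_def monic_of_degree_def)
  moreover have "mat_inner S W P (R j) = 0" if "j < n" for j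
  proof -
    have "mat_inner S W (\<Sum>k<n. mconst (c k) ** R k) (R j) = (\<Sum>k<n. c k ** mat_inner S W (R k) (R j))"
      by (simp add: mat_inner_sum_left[OF W] mat_inner_mconst_left[OF W])
    also have "\<dots> = (\<Sum>k<n. if k = j then c k ** mat_inner S W (R k) (R j) else 0)"
      using R_orth that
      by (intro sum.cong) (auto simp: matrix_mult_zero_right)
    also have "\<dots> = c j ** mat_inner S W (R j) (R j)"
      using that by simp
    also have "\<dots> = mat_inner S W X (R j)"
      by (simp add: c_def matrix_mul_assoc[symmetric] G[OF that])
    finally show ?thesis by (simp add: P_def mat_inner_diff_left[OF W])
  qed
  then have "mat_inner S W Q P = 0" if "\<forall>k\<ge>n. mcoeff Q k = 0" for Q
    using mat_inner_zero_if_orthogonal_to_monics[OF W R, of n P Q] that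
    by (auto intro: mat_inner_zero_sym[OF W])
  ultimately show ?case by blast
qed

lemma is_monic_OP_orthogonal:
  assumes W: "weight_matrix S W" and P: "is_monic_OP S W P"
    and Q: "\<And>k. k \<ge> n \<Longrightarrow> mcoeff Q k = 0"
  shows "mat_inner S W Q (P n) = 0"
  by (rule mat_inner_zero_if_orthogonal_to_monics[OF W _ _ Q, of n P])
     (use P in \<open>auto simp: is_monic_OP_def\<close>)

text \<open>Subtracting the right multiple of \<open>P n\<close> lowers the degree, and the difference is then
  orthogonal to itself.  Both the uniqueness of the orthogonal polynomials and the
  identity \<open>P\<^sub>n \<cdot> V = A\<^sub>n Q\<^sub>n\<close> below are instances.\<close>

lemma orthogonal_eq_multiple:
  assumes W: "weight_matrix S W" and P: "is_monic_OP S W P"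
    and R: "\<And>k. k > n \<Longrightarrow> mcoeff R k = 0"
    and orth: "\<And>Q. (\<And>k. k \<ge> n \<Longrightarrow> mcoeff Q k = 0) \<Longrightarrow> mat_inner S W R Q = 0"
  shows "R = mconst (mcoeff R n) ** P n"
proof -
  define T where "T = R - mconst (mcoeff R n) ** P n"
  have T: "mcoeff T k = 0" if "k \<ge> n" for k
    using P R[of k] that
    by (cases "k = n") (auto simp: T_def is_monic_OP_def monic_of_degree_def
        matrix_mult_zero_right)
  have "mat_inner S W (P n) T = 0"
    using is_monic_OP_orthogonal[OF W P T] by (rule mat_inner_zero_sym[OF W])
  moreover have "mat_inner S W R T = 0" using T by (rule orth)
  moreover have "mat_inner S W T T =
      mat_inner S W R T - mcoeff R n ** mat_inner S W (P n) T"
    by (subst (1) T_def) (simp add: mat_inner_diff_left[OF W] mat_inner_mconst_left[OF W])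
  ultimately have "mat_inner S W T T = 0"
    by (simp add: matrix_mult_zero_right)
  then have "T = 0" by (rule mat_inner_definite[OF W])
  then show ?thesis by (simp add: T_def)
qed

lemma is_monic_OP_monic_OP:
  fixes W :: "real \<Rightarrow> complex^'n^'n"
  assumes W: "weight_matrix S W"
  shows "is_monic_OP S W (monic_OP S W)"
proof -
  obtain P where monic: "\<And>n. monic_of_degree n (P n)"
    and orth: "\<And>n Q. (\<And>k. k \<ge> n \<Longrightarrow> mcoeff Q k = 0) \<Longrightarrow> mat_inner S W Q (P n) = 0"
    using ex_monic_orthogonal[OF W] by metis
  have "mat_inner S W (P m) (P n) = 0" if "m \<noteq> n" for m n
  proof (cases "m < n")
    case True
    then show ?thesis using monic[of m] by (auto simp: monic_of_degree_def intro!: orth)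
  next
    case False
    then have "mat_inner S W (P n) (P m) = 0"
      using monic[of n] that by (auto simp: monic_of_degree_def intro!: orth)
    then show ?thesis by (rule mat_inner_zero_sym[OF W])
  qed
  with monic have P: "is_monic_OP S W P" by (simp add: is_monic_OP_def)
  have "Q = P" if Q: "is_monic_OP S W Q" for Q
  proof
    fix n
    have "Q n = mconst (mcoeff (Q n) n) ** P n"
      by (rule orthogonal_eq_multiple[OF W P])
         (use Q is_monic_OP_orthogonal[OF W Q] in
           \<open>auto simp: is_monic_OP_def monic_of_degree_def intro: mat_inner_zero_sym[OF W]\<close>)
    moreover have "mcoeff (Q n) n = mat 1"
      using Q by (simp add: is_monic_OP_def monic_of_degree_def)
    moreover have "mconst (mat 1 :: complex^'n^'n) = mat 1"
      by (simp add: mconst_def vec_eq_iff mat_def)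
    ultimately show "Q n = P n" by simp
  qed
  with P show ?thesis unfolding monic_OP_def by (rule theI[of _ P])
qed

section \<open>Darboux transformations from adjoint pairs\<close>

text \<open>Let \<open>P\<^sub>n\<close> be the \<open>n\<close>-th orthogonal polynomial of \<open>U1\<close>.  For \<open>Q\<close> of degree less than
  \<open>n\<close>, the inner product of \<open>P\<^sub>n \<cdot> V\<close> with \<open>Q\<close> for \<open>U2\<close> is that of \<open>P\<^sub>n\<close> with \<open>Q \<cdot> N\<close>
  for \<open>U1\<close>, which vanishes because \<open>Q \<cdot> N\<close> has degree less than \<open>n\<close> too.\<close>

lemma dact_monic_OP_eq_multiple:
  fixes U1 U2 :: "real \<Rightarrow> complex^'n^'n"
  assumes U1: "weight_matrix S U1" and U2: "weight_matrix S U2"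
    and V: "degree_preserving V" and N: "degree_preserving N"
    and adj: "\<And>P Q. mat_inner S U2 (dact P V) Q = mat_inner S U1 P (dact Q N)"
  shows "\<exists>A. dact (monic_OP S U1 n) V = mconst A ** monic_OP S U2 n"
proof (rule exI, rule orthogonal_eq_multiple[OF U2 is_monic_OP_monic_OP[OF U2]])
  let ?P = "monic_OP S U1 n"
  have lower: "\<forall>k\<ge>m. mcoeff (dact Q D) k = 0"
    if "degree_preserving D" "\<forall>k\<ge>m. mcoeff Q k = 0" for m D and Q :: "'n mat_poly"
    using that mdegree_less_iff by (metis degree_preserving_def)
  have P: "mcoeff ?P k = 0" if "k > n" for k
    using is_monic_OP_monic_OP[OF U1] that by (simp add: is_monic_OP_def monic_of_degree_def)
  show "mcoeff (dact ?P V) k = 0" if "k > n" for k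
    using lower[OF V, of "Suc n" ?P] P that by auto
  show "mat_inner S U2 (dact ?P V) Q = 0" if "\<And>k. k \<ge> n \<Longrightarrow> mcoeff Q k = 0" for Q
  proof -
    have "\<forall>k\<ge>n. mcoeff (dact Q N) k = 0"
      by (rule lower[OF N]) (simp add: that)
    then have "mat_inner S U1 (dact Q N) ?P = 0"
      by (intro is_monic_OP_orthogonal[OF U1 is_monic_OP_monic_OP[OF U1]]) simp
    then show ?thesis unfolding adj by (rule mat_inner_zero_sym[OF U1])
  qed
qed

text \<open>The adjoint relation is symmetric, so \<open>N\<close> carries the orthogonal polynomials of \<open>U2\<close> back to
  multiples of those of \<open>U1\<close>.  The round trip makes each of the latter an
  eigenfunction of \<open>V N\<close>.\<close>

lemma Darboux_of_adjoint_pair: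
  fixes U1 U2 :: "real \<Rightarrow> complex^'n^'n"
  assumes U1: "weight_matrix S U1" and U2: "weight_matrix S U2"
    and V: "degree_preserving V" and N: "degree_preserving N"
    and adj: "\<And>P Q. mat_inner S U2 (dact P V) Q = mat_inner S U1 P (dact Q N)"
  shows "is_Darboux_transformation_of S U2 U1"
proof -
  have adj': "mat_inner S U1 (dact P N) Q = mat_inner S U2 P (dact Q V)" for P Q
    using adj[of Q P] mat_inner_sym[OF U1, of "dact P N" Q] mat_inner_sym[OF U2, of P "dact Q V"]
    by simp
  have "\<exists>L. dact (monic_OP S U1 n) (dmult V N) = mconst L ** monic_OP S U1 n" for n
  proof -
    obtain A where A: "dact (monic_OP S U1 n) V = mconst A ** monic_OP S U2 n"
      using dact_monic_OP_eq_multiple[OF U1 U2 V N adj] by blast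
    obtain B where B: "dact (monic_OP S U2 n) N = mconst B ** monic_OP S U1 n"
      using dact_monic_OP_eq_multiple[OF U2 U1 N V adj'] by blast
    have "mderiv (mconst A ** P) = mconst A ** mderiv P" for P
      by (rule mat_poly_eqI) (simp add: mcoeff_mderiv
          bounded_bilinear.scaleR_right[OF bounded_bilinear_matrix_mult])
    then have "(mderiv ^^ j) (mconst A ** P) = mconst A ** (mderiv ^^ j) P" for j P
      by (induction j) simp_all
    moreover have "mconst A ** (\<Sum>j\<in>J. f j) = (\<Sum>j\<in>J. mconst A ** f j)" 
      for J :: "nat set" and f :: "nat \<Rightarrow> 'n mat_poly"
      by (induction J rule: infinite_finite_induct) (simp_all add: matmul_0_right matrix_add_ldistrib)
    ultimately have "dact (mconst A ** P) N = mconst A ** dact P N" for P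
      by (simp add: dact_def matrix_mul_assoc)
    then have "dact (monic_OP S U1 n) (dmult V N) = mconst A ** mconst B ** monic_OP S U1 n"
      by (simp add: dact_dmult A B matrix_mul_assoc)
    also have "mconst A ** mconst B = mconst (A ** B)"
      by (rule mat_poly_eqI)
         (simp add: mconst_def vec_eq_iff matrix_matrix_mult_def coeff_sum coeff_pCons
            mult.commute split: nat.split)
    finally show ?thesis by blast
  qed
  then have "dmult V N \<in> bispectral_alg S U1" by (simp add: bispectral_alg_def)
  then show ?thesis
    using dact_monic_OP_eq_multiple[OF U1 U2 V N adj] U1 U2 V N
    unfolding is_Darboux_transformation_of_def by blast
qed

section \<open>First-order operators and their adjoints\<close>

lemma dact_first_order: "dact P (monom F 1 + monom G 0) = mderiv P ** F + P ** G"
  by (simp add: dact_add dact_monom)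

text \<open>If \<open>P\<close> has leading term \<open>A x\<^sup>n\<close>, the coefficient of \<open>x\<^sup>n\<close> in \<open>P \<cdot> (\<partial> F + G)\<close> is
  \<open>A (n F' + G)\<close>.\<close>

lemma degree_preserving_first_order:
  fixes F G :: "'n::finite mat_poly"
  assumes F: "\<And>k. k > 1 \<Longrightarrow> mcoeff F k = 0" and G: "\<And>k. k > 0 \<Longrightarrow> mcoeff G k = 0"
    and inv: "\<And>n. invertible (real n *\<^sub>R mcoeff F 1 + mcoeff G 0)"
  shows "degree_preserving (monom F 1 + monom G 0)"
  unfolding degree_preserving_def
proof
  fix P :: "'n mat_poly"
  let ?Q = "dact P (monom F 1 + monom G 0)"
  have coeff: "mcoeff ?Q k = mcoeff P k ** (real k *\<^sub>R mcoeff F 1 + mcoeff G 0) +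
      real (Suc k) *\<^sub>R (mcoeff P (Suc k) ** mcoeff F 0)" for k
    unfolding dact_first_order using G[of 1]
    by (cases k)
       (simp_all add: mcoeff_linear_mult[of F, OF F] mcoeff_linear_mult[of G, OF G]
         mcoeff_mderiv matrix_add_ldistrib matrix_mult_zero_right
         bounded_bilinear.scaleR_right[OF bounded_bilinear_matrix_mult]
         bounded_bilinear.scaleR_left[OF bounded_bilinear_matrix_mult])
  show "mdegree ?Q = mdegree P"
  proof (cases P rule: mat_poly_degree_cases)
    case 1
    have "?Q = 0"
      by (rule mat_poly_eqI)
         (unfold coeff, simp add: 1 matrix_mult_zero_left)
    with 1 show ?thesis by simp
  next
    case (2 n)
    have "mcoeff ?Q n \<noteq> 0"
    proof
      assume "mcoeff ?Q n = 0"
      then have "mcoeff P n ** (real n *\<^sub>R mcoeff F 1 + mcoeff G 0) = 0"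
        using 2(2)[of "Suc n"]
        unfolding coeff by (simp add: matrix_mult_zero_left)
      moreover obtain B where "(real n *\<^sub>R mcoeff F 1 + mcoeff G 0) ** B = mat 1"
        using inv[of n] by (auto simp: invertible_def)
      ultimately have "mcoeff P n = 0"
        by (metis matrix_mul_assoc matrix_mul_rid
            matrix_mult_zero_left)
      with 2(1) show False ..
    qed
    moreover have "mcoeff ?Q k = 0" if "k > n" for k
      using that 2(2)[of k] 2(2)[of "Suc k"]
      unfolding coeff by (simp add: matrix_mult_zero_left)
    ultimately show ?thesis
      using mdegree_eq[of ?Q n] mdegree_eq[of P n] 2 by simp
  qed
qed

lemma has_vector_derivative_vecI:
  assumes "\<And>i. ((\<lambda>x. f x $ i) has_vector_derivative f' $ i) (at x within S)"
  shows "(f has_vector_derivative f') (at x within S)"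
  unfolding has_vector_derivative_def has_derivative_within
proof
  show "((\<lambda>y. (1 / norm (y - x)) *\<^sub>R (f y - (f x + (y - x) *\<^sub>R f'))) \<longlongrightarrow> 0) (at x within S)"
    using assms unfolding has_vector_derivative_def has_derivative_within
    by (intro vec_tendstoI) simp
qed (rule bounded_linear_scaleR_left)

lemma meval_has_vector_derivative:
  "(meval P has_vector_derivative meval (mderiv P) x) (at x within S)"
proof (intro has_vector_derivative_vecI)
  fix i j
  show "((\<lambda>x. meval P x $ i $ j) has_vector_derivative meval (mderiv P) x $ i $ j) (at x within S)"
    by (simp add: mderiv_def)
       (intro has_vector_derivative_real_field poly_DERIV)
qed

lemma weight_matrix_isCont:
  assumes "weight_matrix S W" "open S" "x \<in> S"
  shows "isCont W x"
proof -
  obtain F :: "nat \<Rightarrow> real \<Rightarrow> _" where F: "\<And>y. y \<in> S \<Longrightarrow> F 0 y = W y"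
    and d: "(F 0 has_vector_derivative F (Suc 0) x) (at x within S)"
    using assms unfolding weight_matrix_def smooth_on_def by blast
  have "(F 0 has_vector_derivative F (Suc 0) x) (at x)"
    using d at_within_open[OF assms(3,2)] by simp
  then have "(W has_vector_derivative F (Suc 0) x) (at x)"
    by (rule has_vector_derivative_transform_within_open[OF _ assms(2,3) F])
  then show ?thesis by (rule has_vector_derivative_continuous)
qed

text \<open>Integration by parts with \<open>V = \<partial> F1 + F0\<close> and \<open>N = \<partial> G1 + G0\<close>.  The hypotheses on
  \<open>F1 U2\<close> say that the derivative of \<open>P F1 U2 Q\<^sup>*\<close> is \<open>(P \<cdot> V) U2 Q\<^sup>* - P U1 (Q \<cdot> N)\<^sup>*\<close>
  and that there are no boundary terms.\<close>

lemma first_order_adjoint: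
  fixes U1 U2 :: "real \<Rightarrow> complex^'n^'n" and a b :: real
  assumes ab: "a < b"
    and U1: "weight_matrix {a<..<b} U1" and U2: "weight_matrix {a<..<b} U2"
    and H: "\<And>x. x \<in> {a<..<b} \<Longrightarrow>
      meval F1 x ** U2 x = - (U1 x ** conj_transpose (meval G1 x))"
    and H': "\<And>x. x \<in> {a<..<b} \<Longrightarrow> ((\<lambda>x. meval F1 x ** U2 x) has_vector_derivative
      (meval F0 x ** U2 x - U1 x ** conj_transpose (meval G0 x))) (at x)"
    and lim_a: "((\<lambda>x. meval F1 x ** U2 x) \<longlongrightarrow> 0) (at_right a)"
    and lim_b: "((\<lambda>x. meval F1 x ** U2 x) \<longlongrightarrow> 0) (at_left b)"
  shows "mat_inner {a<..<b} U2 (dact P (monom F1 1 + monom F0 0)) Q =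
    mat_inner {a<..<b} U1 P (dact Q (monom G1 1 + monom G0 0))"
proof -
  interpret mm: bounded_bilinear "(**) :: complex^'n^'n \<Rightarrow> complex^'n^'n \<Rightarrow> complex^'n^'n"
    by (rule bounded_bilinear_matrix_mult)
  interpret ct: bounded_linear "conj_transpose :: complex^'n^'n \<Rightarrow> complex^'n^'n"
    by (rule bounded_linear_conj_transpose)
  let ?V = "monom F1 1 + monom F0 0" and ?N = "monom G1 1 + monom G0 0"
  define K where "K x = meval P x ** (meval F1 x ** U2 x) ** conj_transpose (meval Q x)" for x
  define f2 where "f2 x = meval (dact P ?V) x ** U2 x ** conj_transpose (meval Q x)" for x
  define f1 where "f1 x = meval P x ** U1 x ** conj_transpose (meval (dact Q ?N) x)" for x
  have int: "set_integrable lborel {a<..<b} f1" "set_integrable lborel {a<..<b} f2"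
    unfolding f1_def f2_def by (intro weight_matrix_integrable U1 U2)+
  have dK: "(K has_vector_derivative (f2 x - f1 x)) (at x)" if x: "x \<in> {a<..<b}" for x
  proof -
    have "(K has_vector_derivative
        (meval P x ** (meval F1 x ** U2 x) ** conj_transpose (meval (mderiv Q) x) +
         (meval P x ** (meval F0 x ** U2 x - U1 x ** conj_transpose (meval G0 x)) +
          meval (mderiv P) x ** (meval F1 x ** U2 x)) ** conj_transpose (meval Q x))) (at x)"
      unfolding K_def
      by (intro mm.has_vector_derivative ct.has_vector_derivative H'[OF x] meval_has_vector_derivative)
    moreover have "meval P x ** (meval F1 x ** U2 x) ** conj_transpose (meval (mderiv Q) x) =
        - (meval P x ** U1 x ** conj_transpose (meval (mderiv Q) x ** meval G1 x))"
      unfolding H[OF x] by (simp add: mm.minus_left mm.minus_right conj_transpose_mult matrix_mul_assoc)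
    ultimately show ?thesis
      unfolding f1_def f2_def dact_first_order
      by (simp add: mm.add_left mm.add_right mm.diff_left mm.diff_right
          ct.add conj_transpose_mult matrix_mul_assoc algebra_simps)
  qed
  have cont: "isCont (\<lambda>x. f2 x - f1 x) x" if x: "x \<in> {a<..<b}" for x
  proof -
    have m: "isCont (meval R) x" for R :: "'n mat_poly"
      using meval_has_vector_derivative by (rule has_vector_derivative_continuous)
    have "isCont U1 x" "isCont U2 x"
      using weight_matrix_isCont[OF U1 _ x] weight_matrix_isCont[OF U2 _ x] by simp_all
    then show ?thesis
      unfolding f1_def f2_def
      by (intro continuous_intros mm.continuous ct.continuous m)
  qed
  have limK: "(K \<longlongrightarrow> 0) F" if "((\<lambda>x. meval F1 x ** U2 x) \<longlongrightarrow> 0) F" "F = at c within X" for F c X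
  proof -
    have m: "(meval R \<longlongrightarrow> meval R c) F" for R :: "'n mat_poly"
      using has_vector_derivative_continuous[OF meval_has_vector_derivative[of R c X]]
      by (simp add: that continuous_within)
    have "(K \<longlongrightarrow> meval P c ** 0 ** conj_transpose (meval Q c)) F"
      unfolding K_def by (intro mm.tendsto ct.tendsto m that)
    then show ?thesis by (simp add: mm.zero_left mm.zero_right)
  qed
  have "(LBINT x=ereal a..ereal b. f2 x - f1 x) = 0 - 0"
  proof (rule interval_integral_FTC_integrable[where F = K])
    show "set_integrable lborel (einterval (ereal a) (ereal b)) (\<lambda>x. f2 x - f1 x)"
      using int by (simp add: set_integral_diff)
    show "((K \<circ> real_of_ereal) \<longlongrightarrow> 0) (at_right (ereal a))"
      using limK[OF lim_a refl] by (simp add: ereal_tendsto_simps)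
    show "((K \<circ> real_of_ereal) \<longlongrightarrow> 0) (at_left (ereal b))"
      using limK[OF lim_b refl] by (simp add: ereal_tendsto_simps)
  qed (use ab dK cont in auto)
  then have "(LINT x:{a<..<b}|lborel. f2 x - f1 x) = 0"
    using ab by (simp add: interval_lebesgue_integral_le_eq)
  then have "(LINT x:{a<..<b}|lborel. f2 x) = (LINT x:{a<..<b}|lborel. f1 x)"
    using int by (simp add: set_integral_diff)
  then show ?thesis by (simp add: mat_inner_def f1_def f2_def)
qed

section \<open>Jacobi-type weights\<close>

definition jacobi_weight :: "real \<Rightarrow> real \<Rightarrow> real \<Rightarrow> real" where
  "jacobi_weight \<alpha> \<beta> x = (1 - x) powr \<alpha> * (1 + x) powr \<beta>"

lemma jacobi_weight_shift:
  assumes "x \<in> {-1<..<1}"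
  shows "jacobi_weight (\<alpha> + 1) (\<beta> + 1) x = (1 - x\<^sup>2) * jacobi_weight \<alpha> \<beta> x"
  using assms by (simp add: jacobi_weight_def powr_add power2_eq_square algebra_simps)

lemma jacobi_weight_has_derivative:
  assumes "x \<in> {-1<..<1}"
  shows "(jacobi_weight \<alpha> \<beta> has_real_derivative
    jacobi_weight (\<alpha> - 1) (\<beta> - 1) x * (\<beta> * (1 - x) - \<alpha> * (1 + x))) (at x within S)"
proof -
  have "(jacobi_weight \<alpha> \<beta> has_real_derivative
      - (\<alpha> * (1 - x) powr (\<alpha> - 1)) * (1 + x) powr \<beta> +
      (1 - x) powr \<alpha> * (\<beta> * (1 + x) powr (\<beta> - 1))) (at x within S)"
    unfolding jacobi_weight_def [abs_def] using assms
    by (auto intro!: derivative_eq_intros simp: algebra_simps)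
  moreover have "(1 - x) powr \<alpha> = (1 - x) powr (\<alpha> - 1) * (1 - x)"
    "(1 + x) powr \<beta> = (1 + x) powr (\<beta> - 1) * (1 + x)"
    using assms by (simp_all add: powr_diff)
  ultimately show ?thesis
    unfolding jacobi_weight_def by (simp add: algebra_simps)
qed

lemma jacobi_weight_tendsto_0:
  assumes "\<alpha> > 0" "\<beta> > 0"
  shows "(jacobi_weight \<alpha> \<beta> \<longlongrightarrow> 0) (at_right (-1))" and "(jacobi_weight \<alpha> \<beta> \<longlongrightarrow> 0) (at_left 1)"
proof -
  have "continuous_on {-1..1} (jacobi_weight \<alpha> \<beta>)"
    unfolding jacobi_weight_def [abs_def] using assms
    by (intro continuous_intros continuous_on_powr') auto
  then show "(jacobi_weight \<alpha> \<beta> \<longlongrightarrow> 0) (at_right (-1))" "(jacobi_weight \<alpha> \<beta> \<longlongrightarrow> 0) (at_left 1)"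
    using continuous_on_Icc_at_rightD[of "-1" 1 "jacobi_weight \<alpha> \<beta>"]
      continuous_on_Icc_at_leftD[of "-1" 1 "jacobi_weight \<alpha> \<beta>"]
    by (simp_all add: jacobi_weight_def)
qed

text \<open>The substitution \<open>t = (1 - x) / 2\<close> turns the weight into the integrand of the Beta function.\<close>

lemma set_integrable_jacobi_weight:
  assumes "\<alpha> > -1" "\<beta> > -1"
  shows "set_integrable lborel {-1<..<1} (jacobi_weight \<alpha> \<beta>)"
proof -
  let ?f = "\<lambda>t::real. t powr \<alpha> * (1 - t) powr \<beta>"
  have "set_integrable lborel {0..1} ?f"
    using integrable_Beta[of "\<alpha> + 1" "\<beta> + 1"] assms by simp
  then have "set_integrable lborel {0<..<1} ?f"
    by (rule set_integrable_subset) auto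
  then have "integrable lborel (\<lambda>t. indicator {0<..<1} t *\<^sub>R ?f t)"
    by (simp add: set_integrable_def)
  then have "integrable lborel (\<lambda>x. indicator {0<..<1} (1/2 + (-1/2) * x) *\<^sub>R ?f (1/2 + (-1/2) * x))"
    by (rule lborel_integrable_real_affine) simp
  then have "integrable lborel (\<lambda>x. (2 powr \<alpha> * 2 powr \<beta>) *
      (indicator {0<..<1} (1/2 + (-1/2) * x) *\<^sub>R ?f (1/2 + (-1/2) * x)))"
    by simp
  moreover have "(2 powr \<alpha> * 2 powr \<beta>) *
      (indicator {0<..<1} (1/2 + (-1/2) * x) *\<^sub>R ?f (1/2 + (-1/2) * x)) =
      indicator {-1<..<1} x *\<^sub>R jacobi_weight \<alpha> \<beta> x" for x :: real
  proof (cases "x \<in> {-1<..<1}")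
    case True
    have "2 powr \<alpha> * (1/2 + (-1/2) * x) powr \<alpha> = (2 * (1/2 + (-1/2) * x)) powr \<alpha>"
      using True by (subst powr_mult) auto
    moreover have "2 powr \<beta> * (1 - (1/2 + (-1/2) * x)) powr \<beta> = (2 * (1 - (1/2 + (-1/2) * x))) powr \<beta>"
      using True by (subst powr_mult) auto
    moreover have "2 * (1/2 + (-1/2) * x) = 1 - x" "2 * (1 - (1/2 + (-1/2) * x)) = 1 + x"
      by simp_all
    ultimately have "2 powr \<alpha> * (1/2 + (-1/2) * x) powr \<alpha> = (1 - x) powr \<alpha>"
      "2 powr \<beta> * (1 - (1/2 + (-1/2) * x)) powr \<beta> = (1 + x) powr \<beta>"
      by simp_all
    moreover have "(2 powr \<alpha> * 2 powr \<beta>) * ?f (1/2 + (-1/2) * x) =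
        (2 powr \<alpha> * (1/2 + (-1/2) * x) powr \<alpha>) * (2 powr \<beta> * (1 - (1/2 + (-1/2) * x)) powr \<beta>)"
      by (simp only: mult_ac)
    ultimately have "(2 powr \<alpha> * 2 powr \<beta>) * ?f (1/2 + (-1/2) * x) = jacobi_weight \<alpha> \<beta> x"
      by (simp only: jacobi_weight_def)
    then show ?thesis using True by simp
  qed auto
  ultimately show ?thesis by (simp only: set_integrable_def)
qed

text \<open>Every derivative of \<open>(1 - x)\<^sup>\<alpha> (1 + x)\<^sup>\<beta> P\<close> has the same form, with both exponents lowered
  by one and \<open>P\<close> replaced by \<open>(1 - x\<^sup>2) P' + (\<beta> (1 - x) - \<alpha> (1 + x)) P\<close>.\<close>

lemma smooth_on_jacobi:
  assumes "\<And>x. x \<in> {-1<..<1} \<Longrightarrow> W x = jacobi_weight \<alpha> \<beta> x *\<^sub>R meval P x"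
  shows "smooth_on {-1<..<1} W"
proof -
  define step where "step a b R =
      map_matrix (\<lambda>p. [:of_real (b - a), of_real (- b - a):] * p + [:1, 0, -1:] * pderiv p) R"
    for a b :: real and R :: "'a mat_poly"
  define R where "R = rec_nat P (\<lambda>k. step (\<alpha> - real k) (\<beta> - real k))"
  define F where "F k x = jacobi_weight (\<alpha> - real k) (\<beta> - real k) x *\<^sub>R meval (R k) x" for k x
  have "(F k has_vector_derivative F (Suc k) x) (at x within {-1<..<1})"
    if x: "x \<in> {-1<..<1}" for k x
  proof -
    define a b where "a = \<alpha> - real k" and "b = \<beta> - real k"
    let ?w = "jacobi_weight (a - 1) (b - 1) x"
    have "(F k has_vector_derivative
        jacobi_weight a b x *\<^sub>R meval (mderiv (R k)) x +
        (?w * (b * (1 - x) - a * (1 + x))) *\<^sub>R meval (R k) x) (at x within {-1<..<1})"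
      unfolding F_def a_def[symmetric] b_def[symmetric]
      by (intro has_vector_derivative_scaleR meval_has_vector_derivative jacobi_weight_has_derivative x)
    moreover have "jacobi_weight a b x = (1 - x\<^sup>2) * ?w"
      using jacobi_weight_shift[OF x, of "a - 1" "b - 1"] by simp
    moreover have "meval (R (Suc k)) x =
        (1 - x\<^sup>2) *\<^sub>R meval (mderiv (R k)) x + (b * (1 - x) - a * (1 + x)) *\<^sub>R meval (R k) x"
      by (simp add: R_def step_def a_def[symmetric] b_def[symmetric] vec_eq_iff mderiv_def
          scaleR_complex power2_eq_square algebra_simps)
    moreover have "\<alpha> - real (Suc k) = a - 1" "\<beta> - real (Suc k) = b - 1"
      by (simp_all add: a_def b_def)
    ultimately show ?thesis
      by (simp add: F_def scaleR_add_right mult.commute del: of_nat_Suc)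
  qed
  moreover have "F 0 x = W x" if "x \<in> {-1<..<1}" for x
    using assms[OF that] by (simp add: F_def R_def)
  ultimately show ?thesis unfolding smooth_on_def by blast
qed

lemma weight_matrix_jacobi:
  assumes "\<alpha> > -1" "\<beta> > -1"
    and W: "\<And>x. x \<in> {-1<..<1} \<Longrightarrow> W x = jacobi_weight \<alpha> \<beta> x *\<^sub>R meval P x"
    and pos: "\<And>x. x \<in> {-1<..<1} \<Longrightarrow> pos_definite (W x)"
  shows "weight_matrix {-1<..<1} W"
proof -
  have "set_integrable lborel {-1<..<1} (\<lambda>x. x ^ k *\<^sub>R W x)" for k
  proof -
    obtain N where N: "\<And>x. meval P x = (\<Sum>l\<le>N. x ^ l *\<^sub>R mcoeff P l)"
      using meval_eq_sum by blast
    have mono: "set_integrable lborel {-1<..<1} (\<lambda>x. jacobi_weight \<alpha> \<beta> x * x ^ m)" for m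
    proof (rule set_integrable_bound[OF set_integrable_jacobi_weight[OF assms(1,2)]])
      show "set_borel_measurable lborel {-1<..<1} (\<lambda>x. jacobi_weight \<alpha> \<beta> x * x ^ m)"
        unfolding set_borel_measurable_def jacobi_weight_def by measurable
      show "AE x in lborel. x \<in> {-1<..<1} \<longrightarrow>
          norm (jacobi_weight \<alpha> \<beta> x * x ^ m) \<le> norm (jacobi_weight \<alpha> \<beta> x)"
        by (intro AE_I2 impI)
           (auto simp: abs_mult power_abs intro!: mult_left_le power_le_one)
    qed
    have "set_integrable lborel {-1<..<1}
        (\<lambda>x. \<Sum>l\<le>N. (jacobi_weight \<alpha> \<beta> x * x ^ (k + l)) *\<^sub>R mcoeff P l)"
      using set_integrable_scaleR_left[OF mono]
      unfolding set_integrable_def scaleR_sum_right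
      by (intro Bochner_Integration.integrable_sum) blast
    moreover have "x ^ k *\<^sub>R W x = (\<Sum>l\<le>N. (jacobi_weight \<alpha> \<beta> x * x ^ (k + l)) *\<^sub>R mcoeff P l)"
      if "x \<in> {-1<..<1}" for x
      unfolding W[OF that] N by (simp add: scaleR_sum_right power_add mult_ac)
    ultimately show ?thesis
      by (subst set_integrable_cong[OF refl refl])
  qed
  moreover have "interior {-1<..<(1::real)} \<noteq> {}" by simp
  ultimately show ?thesis
    using pos smooth_on_jacobi[OF W] unfolding weight_matrix_def
    by (auto simp: is_interval_oo intro!: AE_I2)
qed

section \<open>Real \<open>2\<times>2\<close> matrices\<close>

definition rmat :: "real \<Rightarrow> real \<Rightarrow> real \<Rightarrow> real \<Rightarrow> complex^2^2" where
  "rmat a b c d = vector [vector [of_real a, of_real b], vector [of_real c, of_real d]]"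

definition rmat_poly :: "real poly \<Rightarrow> real poly \<Rightarrow> real poly \<Rightarrow> real poly \<Rightarrow> 2 mat_poly" where
  "rmat_poly p q r s = vector [vector [map_poly of_real p, map_poly of_real q],
    vector [map_poly of_real r, map_poly of_real s]]"

lemma rmat_simps:
  "rmat a b c d + rmat a' b' c' d' = rmat (a + a') (b + b') (c + c') (d + d')"
  "rmat a b c d - rmat a' b' c' d' = rmat (a - a') (b - b') (c - c') (d - d')"
  "- rmat a b c d = rmat (- a) (- b) (- c) (- d)"
  "k *\<^sub>R rmat a b c d = rmat (k * a) (k * b) (k * c) (k * d)"
  "rmat a b c d ** rmat a' b' c' d' =
    rmat (a * a' + b * c') (a * b' + b * d') (c * a' + d * c') (c * b' + d * d')"
  "conj_transpose (rmat a b c d) = rmat a c b d"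
  "mat 1 = rmat 1 0 0 1"
  by (simp_all add: rmat_def vec_eq_iff forall_2 matrix_matrix_mult_def sum_2 mat_def scaleR_complex)

lemma invertible_rmat: "a * d - b * c \<noteq> 0 \<Longrightarrow> invertible (rmat a b c d)"
  by (simp add: invertible_det_nz det_2 rmat_def flip: of_real_mult of_real_diff)

lemma mcoeff_rmat_poly:
  "mcoeff (rmat_poly p q r s) k = rmat (coeff p k) (coeff q k) (coeff r k) (coeff s k)"
  by (simp add: vec_eq_iff forall_2 rmat_def rmat_poly_def coeff_map_poly)

lemma meval_rmat_poly:
  "meval (rmat_poly p q r s) x = rmat (poly p x) (poly q x) (poly r x) (poly s x)"
proof -
  have "poly (map_poly of_real p) (complex_of_real x) = of_real (poly p x)" for p
    by (induction p) (simp_all add: map_poly_pCons)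
  then show ?thesis by (simp add: vec_eq_iff forall_2 rmat_def rmat_poly_def)
qed

lemma mderiv_rmat_poly:
  "mderiv (rmat_poly p q r s) = rmat_poly (pderiv p) (pderiv q) (pderiv r) (pderiv s)"
  by (rule mat_poly_eqI) (simp add: mcoeff_mderiv mcoeff_rmat_poly rmat_simps coeff_pderiv)

lemma pos_definite_rmat:
  assumes "a > 0" "b\<^sup>2 < a * d"
  shows "pos_definite (rmat a b b d)"
  unfolding pos_definite_def
proof (intro conjI allI impI)
  fix z :: "complex^2" assume "z \<noteq> 0"
  define x y u w where "x = Re (z $ 1)" "y = Im (z $ 1)" "u = Re (z $ 2)" "w = Im (z $ 2)"
  let ?q = "a * (x\<^sup>2 + y\<^sup>2) + d * (u\<^sup>2 + w\<^sup>2) + 2 * b * (x * u + y * w)"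
  have "Re (\<Sum>i\<in>UNIV. \<Sum>j\<in>UNIV. cnj (z $ i) * rmat a b b d $ i $ j * z $ j) = ?q"
    by (simp add: sum_2 rmat_def x_y_u_w_def power2_eq_square algebra_simps)
  \<comment> \<open>completing the square\<close>
  moreover have "a * ?q = (a * x + b * u)\<^sup>2 + (a * y + b * w)\<^sup>2 + (a * d - b\<^sup>2) * (u\<^sup>2 + w\<^sup>2)"
    by (simp add: power2_eq_square algebra_simps)
  moreover have "\<dots> > 0"
  proof (cases "u = 0 \<and> w = 0")
    case True
    then have "x\<^sup>2 + y\<^sup>2 > 0"
      using \<open>z \<noteq> 0\<close> by (auto simp: x_y_u_w_def vec_eq_iff forall_2 complex_eq_iff sum_power2_gt_zero_iff)
    then have "a\<^sup>2 * (x\<^sup>2 + y\<^sup>2) > 0" using assms by simp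
    then show ?thesis using True by (simp add: power_mult_distrib algebra_simps)
  next
    case False
    then have "(a * d - b\<^sup>2) * (u\<^sup>2 + w\<^sup>2) > 0"
      using assms by (auto simp: sum_power2_gt_zero_iff)
    then show ?thesis by (smt (verit) zero_le_power2)
  qed
  ultimately show "0 < Re (\<Sum>i\<in>UNIV. \<Sum>j\<in>UNIV. cnj (z $ i) * rmat a b b d $ i $ j * z $ j)"
    using assms(1) by (metis zero_less_mult_pos)
qed (simp add: rmat_simps)

section \<open>The Darboux pair between the two Jacobi-type weights\<close>

text \<open>The quadratic polynomial \<open>M\<close> with \<open>W = (1 - x)\<^sup>\<alpha> (1 + x)\<^sup>\<beta> M\<close>, expanded in powers of \<open>x\<close>.
  Throughout, \<open>s = \<alpha> + \<beta> + 2\<close>, \<open>p = v + \<alpha> - \<beta>\<close> and \<open>q = v - \<alpha> + \<beta>\<close>, so that \<open>p + q = 2 v\<close>.\<close>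

definition W_poly :: "real \<Rightarrow> real \<Rightarrow> real \<Rightarrow> 2 mat_poly" where
  "W_poly \<alpha> \<beta> v = (let s = \<alpha> + \<beta> + 2; c = v * (s + v) / (v + \<alpha> - \<beta>); d = v * (s - v) / (v - \<alpha> + \<beta>) in
    rmat_poly [:c / 4 - (s + v) / 2 + (\<alpha> + 1), (s + v) / 2 - c / 2, c / 4:]
      [:s / 2 - (\<alpha> + 1), - (s / 2):]
      [:s / 2 - (\<alpha> + 1), - (s / 2):]
      [:d / 4 - (s - v) / 2 + (\<alpha> + 1), (s - v) / 2 - d / 2, d / 4:])"

text \<open>For \<open>V1 W\<close> to be a polynomial multiple of \<open>(1 - x)\<^sup>\<alpha>\<^sup>+\<^sup>1 (1 + x)\<^sup>\<beta>\<^sup>+\<^sup>1\<close>, the matrix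
  \<open>V1 M\<close> has to vanish at \<open>1\<close> and \<open>-1\<close>.  There \<open>M\<close> has rank one, with left kernels
  spanned by \<open>(1, 1)\<close> and \<open>(p, - q)\<close>; up to a constant factor on the left, \<open>V1\<close> is the
  linear polynomial with independent rows whose values at \<open>1\<close> and \<open>-1\<close> lie in these kernels.\<close>

definition V1 :: "real \<Rightarrow> real \<Rightarrow> real \<Rightarrow> 2 mat_poly" where
  "V1 \<alpha> \<beta> v = (let p = v + \<alpha> - \<beta>; q = v - \<alpha> + \<beta> in
    rmat_poly [:1, 1:] [:1, 1:] [:- p, p:] [:q, - q:])"

text \<open>The constant term of the operator is forced by the requirement that the adjoint have
  polynomial coefficients: at each endpoint the numerator of its constant term has to vanish.\<close>

definition V0 :: "real \<Rightarrow> real \<Rightarrow> real \<Rightarrow> 2 mat_poly" where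
  "V0 \<alpha> \<beta> v = (let s = \<alpha> + \<beta> + 2; p = v + \<alpha> - \<beta>; q = v - \<alpha> + \<beta> in
    rmat_poly [:(s + v) / 2:] [:(s - v) / 2:] [:(s + v) * p / 2:] [:- (s - v) * q / 2:])"

text \<open>The adjoint \<open>\<partial> N1 + N0\<close>.  Its leading coefficient is read off from
  \<open>V1 M = - (1 - x\<^sup>2) N1\<^sup>*\<close>, and \<open>N0\<close> from the derivative of this product with the weight.\<close>

definition N1 :: "real \<Rightarrow> real \<Rightarrow> real \<Rightarrow> 2 mat_poly" where
  "N1 \<alpha> \<beta> v = (let s = \<alpha> + \<beta> + 2; p = v + \<alpha> - \<beta>; q = v - \<alpha> + \<beta> in
    rmat_poly [:v / 2 - v * (s + v) / (4 * p), v * (s + v) / (4 * p):]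
      [:v * (\<alpha> + 1) - v * (s + v) / 4, v * (s + v) / 4:]
      [:- (v / 2) - v * (s - v) / (4 * q), v * (s - v) / (4 * q):]
      [:v * (s - v) / 4 - v * (\<alpha> + 1), - (v * (s - v) / 4):])"

definition N0 :: "real \<Rightarrow> real \<Rightarrow> real \<Rightarrow> 2 mat_poly" where
  "N0 \<alpha> \<beta> v = (let s = \<alpha> + \<beta> + 2; p = v + \<alpha> - \<beta>; q = v - \<alpha> + \<beta> in
    rmat_poly [:v * (s + v) * (2 + s - v) / (8 * p):] [:v * (s + v) * (2 + s - v) / 8:]
      [:v * (s - v) * (2 + s + v) / (8 * q):] [:- (v * (s - v) * (2 + s + v) / 8):])"

lemma rmat_cong:
  "a = a' \<Longrightarrow> b = b' \<Longrightarrow> c = c' \<Longrightarrow> d = d' \<Longrightarrow> rmat a b c d = rmat a' b' c' d'"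
  by simp

lemma V1_mult_W_poly:
  assumes "v + \<alpha> - \<beta> \<noteq> 0" "v - \<alpha> + \<beta> \<noteq> 0"
  shows "meval (V1 \<alpha> \<beta> v) x ** meval (W_poly \<alpha> \<beta> v) x =
    - ((1 - x\<^sup>2) *\<^sub>R conj_transpose (meval (N1 \<alpha> \<beta> v) x))"
proof -
  \<comment> \<open>in terms of \<open>\<alpha>\<close>, \<open>p\<close>, \<open>q\<close> the denominators are the variables \<open>p\<close> and \<open>q\<close>\<close>
  define p q where "p = v + \<alpha> - \<beta>" and "q = v - \<alpha> + \<beta>"
  have v: "v = (p + q) / 2" and b: "\<beta> = \<alpha> - (p - q) / 2"
    by (simp_all add: p_def q_def field_simps)
  have "p \<noteq> 0" "q \<noteq> 0" using assms by (simp_all add: p_def q_def)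
  then show ?thesis
    unfolding V1_def W_poly_def N1_def Let_def p_def[symmetric] q_def[symmetric] meval_rmat_poly rmat_simps
    unfolding v b
    by (intro rmat_cong) (simp_all add: field_simps power2_eq_square)
qed

text \<open>Multiplied by \<open>(1 - x)\<^sup>\<alpha> (1 + x)\<^sup>\<beta>\<close>, this says that the derivative of \<open>V1 W\<close> is
  \<open>V0 W\<close> minus the diagonal weight times \<open>N0\<^sup>*\<close>, as integration by parts demands.\<close>

lemma V0_mult_W_poly:
  assumes "v + \<alpha> - \<beta> \<noteq> 0" "v - \<alpha> + \<beta> \<noteq> 0"
  shows "meval (V0 \<alpha> \<beta> v) x ** meval (W_poly \<alpha> \<beta> v) x =
    (1 - x\<^sup>2) *\<^sub>R conj_transpose (meval (N0 \<alpha> \<beta> v) x - meval (mderiv (N1 \<alpha> \<beta> v)) x) -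
    ((\<beta> + 1) * (1 - x) - (\<alpha> + 1) * (1 + x)) *\<^sub>R conj_transpose (meval (N1 \<alpha> \<beta> v) x)"
proof -
  \<comment> \<open>in terms of \<open>\<alpha>\<close>, \<open>p\<close>, \<open>q\<close> the denominators are the variables \<open>p\<close> and \<open>q\<close>\<close>
  define p q where "p = v + \<alpha> - \<beta>" and "q = v - \<alpha> + \<beta>"
  have v: "v = (p + q) / 2" and b: "\<beta> = \<alpha> - (p - q) / 2"
    by (simp_all add: p_def q_def field_simps)
  have "p \<noteq> 0" "q \<noteq> 0" using assms by (simp_all add: p_def q_def)
  then show ?thesis
    unfolding V0_def W_poly_def N1_def N0_def Let_def p_def[symmetric] q_def[symmetric]
      meval_rmat_poly mderiv_rmat_poly rmat_simps
    unfolding v b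
    by (intro rmat_cong) (simp_all add: pderiv_pCons field_simps power2_eq_square)
qed

text \<open>The first inequality says that \<open>v + \<alpha> - \<beta>\<close> and \<open>v - \<alpha> + \<beta>\<close> have the sign of \<open>v\<close>; adding
  both gives \<open>\<alpha>, \<beta> > -1\<close>.\<close>

lemma parameter_signs:
  fixes \<alpha> \<beta> v :: real
  assumes "\<bar>\<alpha> - \<beta>\<bar> < \<bar>v\<bar>" and "\<bar>v\<bar> < \<alpha> + \<beta> + 2"
  shows "\<alpha> > -1" "\<beta> > -1" "\<alpha> + \<beta> + 2 + v > 0" "\<alpha> + \<beta> + 2 - v > 0"
    and "v / (v + \<alpha> - \<beta>) > 0" "v / (v - \<alpha> + \<beta>) > 0"
  using assms by (auto simp: zero_less_divide_iff)

text \<open>The matrix \<open>n V1' + V0\<close> is the product of the matrix with rows \<open>(1, 1)\<close>, \<open>(p, - q)\<close> and the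
  diagonal matrix with entries \<open>n + (s + v) / 2\<close> and \<open>n + (s - v) / 2\<close>, which are positive
  because \<open>\<bar>v\<bar> < s\<close>.\<close>

lemma degree_preserving_V:
  assumes "\<bar>\<alpha> - \<beta>\<bar> < \<bar>v\<bar>" and "\<bar>v\<bar> < \<alpha> + \<beta> + 2"
  shows "degree_preserving (monom (V1 \<alpha> \<beta> v) 1 + monom (V0 \<alpha> \<beta> v) 0)"
proof (rule degree_preserving_first_order)
  fix n
  define y z where "y = real n + (\<alpha> + \<beta> + 2 + v) / 2" and "z = real n + (\<alpha> + \<beta> + 2 - v) / 2"
  note signs = parameter_signs[OF assms]
  have "y > 0" "z > 0" using signs by (auto simp: y_def z_def intro: add_nonneg_pos)
  moreover have "v \<noteq> 0" using assms by auto
  ultimately have "y * z * (2 * v) \<noteq> 0" by simp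
  moreover have "y * (- (v - \<alpha> + \<beta>) * z) - z * ((v + \<alpha> - \<beta>) * y) = - (y * z * (2 * v))"
    by (simp add: algebra_simps)
  ultimately have "invertible (rmat y z ((v + \<alpha> - \<beta>) * y) (- (v - \<alpha> + \<beta>) * z))"
    by (intro invertible_rmat) simp
  also have "rmat y z ((v + \<alpha> - \<beta>) * y) (- (v - \<alpha> + \<beta>) * z) =
      real n *\<^sub>R mcoeff (V1 \<alpha> \<beta> v) 1 + mcoeff (V0 \<alpha> \<beta> v) 0"
    unfolding V1_def V0_def Let_def mcoeff_rmat_poly rmat_simps y_def z_def
    by (intro rmat_cong) (simp_all add: field_simps)
  finally show "invertible (real n *\<^sub>R mcoeff (V1 \<alpha> \<beta> v) 1 + mcoeff (V0 \<alpha> \<beta> v) 0)" .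
qed (auto simp: V1_def V0_def Let_def mcoeff_rmat_poly rmat_def vec_eq_iff forall_2 coeff_pCons
    split: nat.splits)

text \<open>Here \<open>n N1' + N0\<close> is the product of an invertible diagonal matrix and the matrix with rows
  \<open>(1 / p, 1)\<close>, \<open>(1 / q, - 1)\<close>, whose determinant is \<open>- 2 v / (p q)\<close>.\<close>

lemma degree_preserving_N:
  assumes "\<bar>\<alpha> - \<beta>\<bar> < \<bar>v\<bar>" and "\<bar>v\<bar> < \<alpha> + \<beta> + 2"
  shows "degree_preserving (monom (N1 \<alpha> \<beta> v) 1 + monom (N0 \<alpha> \<beta> v) 0)"
proof (rule degree_preserving_first_order)
  fix n
  define p q where "p = v + \<alpha> - \<beta>" and "q = v - \<alpha> + \<beta>"
  define y where "y = v * (\<alpha> + \<beta> + 2 + v) * (real n + 1 + (\<alpha> + \<beta> + 2 - v) / 2) / 4"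
  define z where "z = v * (\<alpha> + \<beta> + 2 - v) * (real n + 1 + (\<alpha> + \<beta> + 2 + v) / 2) / 4"
  note signs = parameter_signs[OF assms, folded p_def q_def]
  have v: "v \<noteq> 0" "p \<noteq> 0" "q \<noteq> 0" using signs by auto
  have "real n + 1 + (\<alpha> + \<beta> + 2 - v) / 2 > 0" "real n + 1 + (\<alpha> + \<beta> + 2 + v) / 2 > 0"
    using signs by (auto intro: add_nonneg_pos)
  then have yz: "y \<noteq> 0" "z \<noteq> 0" unfolding y_def z_def using signs v by simp_all
  have "y / p * (- z) - y * (z / q) = - (y * z * (2 * v) / (p * q))"
    using v by (simp add: divide_simps) (simp add: p_def q_def algebra_simps)
  then have "invertible (rmat (y / p) y (z / q) (- z))"
    using yz v by (intro invertible_rmat) simp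
  also have "rmat (y / p) y (z / q) (- z) =
      real n *\<^sub>R mcoeff (N1 \<alpha> \<beta> v) 1 + mcoeff (N0 \<alpha> \<beta> v) 0"
    unfolding N1_def N0_def Let_def mcoeff_rmat_poly rmat_simps y_def z_def
      p_def[symmetric] q_def[symmetric]
    using v by (intro rmat_cong) (simp_all add: field_simps)
  finally show "invertible (real n *\<^sub>R mcoeff (N1 \<alpha> \<beta> v) 1 + mcoeff (N0 \<alpha> \<beta> v) 0)" .
qed (auto simp: N1_def N0_def Let_def mcoeff_rmat_poly rmat_def vec_eq_iff forall_2 coeff_pCons
    split: nat.splits)

text \<open>In the variable \<open>t = (1 - x) / 2\<close> the determinant is a positive multiple of \<open>t\<^sup>2 (1 - t)\<^sup>2\<close>, and
  the upper left entry is a quadratic with negative discriminant \<open>- (s + v) (s - v) q / p\<close>.\<close>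

lemma pos_definite_W_poly:
  assumes "\<bar>\<alpha> - \<beta>\<bar> < \<bar>v\<bar>" and "\<bar>v\<bar> < \<alpha> + \<beta> + 2" and x: "x \<in> {-1<..<1}"
  shows "pos_definite (meval (W_poly \<alpha> \<beta> v) x)"
proof -
  define p q where "p = v + \<alpha> - \<beta>" and "q = v - \<alpha> + \<beta>"
  define s where "s = \<alpha> + \<beta> + 2"
  define t where "t = (1 - x) / 2"
  note signs = parameter_signs[OF assms(1,2), folded p_def q_def s_def]
  have nz: "v \<noteq> 0" "p \<noteq> 0" "q \<noteq> 0" using signs by auto
  have t: "t > 0" "t < 1" using x by (auto simp: t_def)
  define c where "c = v * (s + v) / p"
  define d where "d = v * (s - v) / q"
  define m11 m12 m22 where "m11 = c * t\<^sup>2 - (s + v) * t + (\<alpha> + 1)"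
    and "m12 = s * t - (\<alpha> + 1)" and "m22 = d * t\<^sup>2 - (s - v) * t + (\<alpha> + 1)"
  have v: "v = (p + q) / 2" and \<alpha>: "\<alpha> = (s - 2 + (p - q) / 2) / 2"
    by (simp_all add: p_def q_def s_def field_simps)
  have eq: "meval (W_poly \<alpha> \<beta> v) x = rmat m11 m12 m12 m22"
    unfolding W_poly_def Let_def meval_rmat_poly p_def[symmetric] q_def[symmetric] s_def[symmetric]
      c_def[symmetric] d_def[symmetric]
    by (intro rmat_cong) (simp_all add: m11_def m12_def m22_def t_def field_simps power2_eq_square)
  have pq: "(v / p) * (v / q) > 0" using signs(5,6) by (rule mult_pos_pos)
  have c: "c > 0" using signs mult_pos_pos[of "v / p" "s + v"] by (simp add: c_def)
  have "4 * c * (\<alpha> + 1) - (s + v)\<^sup>2 = (s + v) * (s - v) * (q / p)"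
    unfolding c_def v \<alpha> using nz(2) by (simp add: divide_simps) algebra
  then have "4 * c * m11 = (2 * c * t - (s + v))\<^sup>2 + (s + v) * (s - v) * (q / p)"
    unfolding m11_def by algebra
  moreover have "q / p > 0"
    using signs(5,6) by (auto simp: zero_less_divide_iff)
  then have "(s + v) * (s - v) * (q / p) > 0" using signs(3,4) by (intro mult_pos_pos)
  ultimately have "4 * c * m11 > 0" by (smt (verit) zero_le_power2)
  then have "m11 > 0" using c by (simp add: zero_less_mult_iff)
  moreover have "m11 * m22 - m12\<^sup>2 = ((v / p) * (v / q)) * (s + v) * (s - v) * (t * (1 - t))\<^sup>2"
  proof -
    have "c * d = ((v / p) * (v / q)) * (s + v) * (s - v)"
      by (simp add: c_def d_def)
    moreover have "c * (s - v) + d * (s + v) = 2 * (c * d)"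
      unfolding c_def d_def v using nz(2,3) by (simp add: divide_simps) algebra
    moreover have "(c + d) * (\<alpha> + 1) = c * d + v\<^sup>2"
      unfolding c_def d_def v \<alpha> using nz(2,3) by (simp add: divide_simps) algebra
    ultimately show ?thesis unfolding m11_def m12_def m22_def by algebra
  qed
  moreover have "\<dots> > 0"
    using pq signs t by (intro mult_pos_pos zero_less_power) auto
  ultimately show ?thesis unfolding eq by (intro pos_definite_rmat) simp_all
qed

lemma pos_definite_scaleR:
  assumes "r > 0" "pos_definite A"
  shows "pos_definite (r *\<^sub>R A)"
  unfolding pos_definite_def
proof (intro conjI allI impI)
  show "conj_transpose (r *\<^sub>R A) = r *\<^sub>R A"
    using assms(2) by (simp add: pos_definite_def vec_eq_iff)
  fix z :: "complex ^ 'a" assume "z \<noteq> 0"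
  then have "0 < Re (\<Sum>i\<in>UNIV. \<Sum>j\<in>UNIV. cnj (z $ i) * A $ i $ j * z $ j)"
    using assms(2) by (simp add: pos_definite_def)
  then have "0 < r * Re (\<Sum>i\<in>UNIV. \<Sum>j\<in>UNIV. cnj (z $ i) * A $ i $ j * z $ j)"
    using assms(1) by (rule mult_pos_pos[rotated])
  then show "0 < Re (\<Sum>i\<in>UNIV. \<Sum>j\<in>UNIV. cnj (z $ i) * (r *\<^sub>R A) $ i $ j * z $ j)"
    by (simp add: sum_distrib_left)
qed

theorem theorem7p1:
  fixes \<alpha> \<beta> v :: real
    and W2 W1 W0 :: "complex ^ 2 ^ 2"
    and W Wt :: "real \<Rightarrow> complex ^ 2 ^ 2"
  assumes "\<bar>\<alpha> - \<beta>\<bar> < \<bar>v\<bar>" and "\<bar>v\<bar> < \<alpha> + \<beta> + 2"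
    and "W2 = vector [vector [of_real (v * (v + 2 + \<alpha> + \<beta>) / (v + \<alpha> - \<beta>)), 0],
                      vector [0, of_real (v * (- v + 2 + \<alpha> + \<beta>) / (v - \<alpha> + \<beta>))]]"
    and "W1 = vector [vector [of_real (- (v + \<alpha> + \<beta> + 2)), of_real (\<alpha> + \<beta> + 2)],
                      vector [of_real (\<alpha> + \<beta> + 2), of_real (- (- v + \<alpha> + \<beta> + 2))]]"
    and "W0 = vector [vector [of_real (\<alpha> + 1), of_real (- \<alpha> - 1)],
                      vector [of_real (- \<alpha> - 1), of_real (\<alpha> + 1)]]"
    and "\<And>x. x \<in> {-1<..<1} \<Longrightarrow>
           W x = ((1 - x) powr \<alpha> * (1 + x) powr \<beta>) *\<^sub>R
             (((1 - x)\<^sup>2 / 4) *\<^sub>R W2 + ((1 - x) / 2) *\<^sub>R W1 + W0)"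
    and "\<And>x. x \<in> {-1<..<1} \<Longrightarrow>
           Wt x = ((1 - x) powr (\<alpha> + 1) * (1 + x) powr (\<beta> + 1)) *\<^sub>R mat 1"
  shows "is_Darboux_transformation_of {-1<..<1} W Wt"
proof -
  note signs = parameter_signs[OF assms(1,2)]
  have nz: "v + \<alpha> - \<beta> \<noteq> 0" "v - \<alpha> + \<beta> \<noteq> 0" using signs by auto
  interpret mm: bounded_bilinear "(**) :: complex^2^2 \<Rightarrow> complex^2^2 \<Rightarrow> complex^2^2"
    by (rule bounded_bilinear_matrix_mult)
  interpret ct: bounded_linear "conj_transpose :: complex^2^2 \<Rightarrow> complex^2^2"
    by (rule bounded_linear_conj_transpose)
  have W: "W x = jacobi_weight \<alpha> \<beta> x *\<^sub>R meval (W_poly \<alpha> \<beta> v) x" if "x \<in> {-1<..<1}" for x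
  proof -
    define c d where "c = v * (v + 2 + \<alpha> + \<beta>) / (v + \<alpha> - \<beta>)"
      and "d = v * (- v + 2 + \<alpha> + \<beta>) / (v - \<alpha> + \<beta>)"
    have "W2 = rmat c 0 0 d"
      "W1 = rmat (- (v + \<alpha> + \<beta> + 2)) (\<alpha> + \<beta> + 2) (\<alpha> + \<beta> + 2) (- (- v + \<alpha> + \<beta> + 2))"
      "W0 = rmat (\<alpha> + 1) (- \<alpha> - 1) (- \<alpha> - 1) (\<alpha> + 1)"
      unfolding assms(3-5) rmat_def c_def d_def by simp_all
    moreover have "v * (\<alpha> + \<beta> + 2 + v) / (v + \<alpha> - \<beta>) = c" "v * (\<alpha> + \<beta> + 2 - v) / (v - \<alpha> + \<beta>) = d"
      by (simp_all add: c_def d_def algebra_simps)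
    ultimately have "((1 - x)\<^sup>2 / 4) *\<^sub>R W2 + ((1 - x) / 2) *\<^sub>R W1 + W0 = meval (W_poly \<alpha> \<beta> v) x"
      unfolding W_poly_def Let_def meval_rmat_poly
      by (simp only: rmat_simps, intro rmat_cong)
         (simp_all add: field_simps power2_eq_square)
    with assms(6)[OF that] show ?thesis by (simp add: jacobi_weight_def)
  qed
  have Wt: "Wt x = jacobi_weight (\<alpha> + 1) (\<beta> + 1) x *\<^sub>R mat 1" if "x \<in> {-1<..<1}" for x
    using assms(7)[OF that] by (simp add: jacobi_weight_def)
  have jpos: "jacobi_weight a b x > 0" if "x \<in> {-1<..<1}" for a b x
    using that by (simp add: jacobi_weight_def)
  have weight_W: "weight_matrix {-1<..<1} W"
    using signs W jpos pos_definite_W_poly[OF assms(1,2)]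
    by (intro weight_matrix_jacobi[of \<alpha> \<beta> W "W_poly \<alpha> \<beta> v"]) (auto intro: pos_definite_scaleR)
  have one: "meval (rmat_poly 1 0 0 1) x = mat 1" for x
    by (simp add: meval_rmat_poly rmat_simps)
  have "pos_definite (mat 1 :: complex^2^2)"
    unfolding rmat_simps by (rule pos_definite_rmat) simp_all
  then have weight_Wt: "weight_matrix {-1<..<1} Wt"
    using signs Wt jpos
    by (intro weight_matrix_jacobi[of "\<alpha> + 1" "\<beta> + 1" Wt "rmat_poly 1 0 0 1"])
       (auto simp: one intro: pos_definite_scaleR)
  \<comment> \<open>the polynomial quotient of \<open>V1 W\<close> by the scalar Jacobi weight \<open>w\<close>\<close>
  define \<Phi> where "\<Phi> x = - conj_transpose (meval (N1 \<alpha> \<beta> v) x)" for x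
  define w where "w = jacobi_weight (\<alpha> + 1) (\<beta> + 1)"
  have V1W: "meval (V1 \<alpha> \<beta> v) x ** W x = w x *\<^sub>R \<Phi> x" if "x \<in> {-1<..<1}" for x
    using jacobi_weight_shift[OF that, of \<alpha> \<beta>]
    by (simp add: W[OF that] mm.scaleR_right V1_mult_W_poly[OF nz] w_def \<Phi>_def mult.commute)
  have \<Phi>': "(\<Phi> has_vector_derivative - conj_transpose (meval (mderiv (N1 \<alpha> \<beta> v)) x)) (at x)" for x
    unfolding \<Phi>_def
    by (intro has_vector_derivative_minus ct.has_vector_derivative meval_has_vector_derivative)
  have lim: "((\<lambda>x. meval (V1 \<alpha> \<beta> v) x ** W x) \<longlongrightarrow> 0) F"
    if "(w \<longlongrightarrow> 0) F" "F = at c within X" "\<forall>\<^sub>F x in F. x \<in> {-1<..<1}" for F c X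
  proof -
    have "(\<Phi> \<longlongrightarrow> \<Phi> c) F"
      using continuous_at_imp_continuous_within[OF has_vector_derivative_continuous[OF \<Phi>'[of c]]]
      unfolding that(2) by (simp add: continuous_within)
    then have "((\<lambda>x. w x *\<^sub>R \<Phi> x) \<longlongrightarrow> 0 *\<^sub>R \<Phi> c) F" by (intro tendsto_scaleR that)
    then have "((\<lambda>x. w x *\<^sub>R \<Phi> x) \<longlongrightarrow> 0) F" by simp
    then show ?thesis
      by (rule Lim_transform_eventually)
         (use that(3) in eventually_elim, simp add: V1W)
  qed
  show ?thesis
  proof (rule Darboux_of_adjoint_pair[OF weight_Wt weight_W degree_preserving_V degree_preserving_N,
        OF assms(1,2) assms(1,2)], rule first_order_adjoint)
    show "meval (V1 \<alpha> \<beta> v) x ** W x = - (Wt x ** conj_transpose (meval (N1 \<alpha> \<beta> v) x))"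
      if "x \<in> {-1<..<1}" for x
      by (simp add: V1W[OF that] Wt[OF that] \<Phi>_def w_def mm.scaleR_left)
    show "((\<lambda>x. meval (V1 \<alpha> \<beta> v) x ** W x) has_vector_derivative
        (meval (V0 \<alpha> \<beta> v) x ** W x - Wt x ** conj_transpose (meval (N0 \<alpha> \<beta> v) x))) (at x)"
      if x: "x \<in> {-1<..<1}" for x
    proof (rule has_vector_derivative_transform_within_open[OF _ _ x])
      let ?r = "jacobi_weight \<alpha> \<beta> x"
      have "((\<lambda>x. w x *\<^sub>R \<Phi> x) has_vector_derivative
          w x *\<^sub>R - conj_transpose (meval (mderiv (N1 \<alpha> \<beta> v)) x) +
          (?r * ((\<beta> + 1) * (1 - x) - (\<alpha> + 1) * (1 + x))) *\<^sub>R \<Phi> x) (at x)"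
        using jacobi_weight_has_derivative[OF x, of "\<alpha> + 1" "\<beta> + 1" UNIV]
        unfolding w_def by (intro has_vector_derivative_scaleR \<Phi>') simp
      moreover have "w x = ?r * (1 - x\<^sup>2)"
        using jacobi_weight_shift[OF x, of \<alpha> \<beta>] by (simp add: w_def mult.commute)
      ultimately show "((\<lambda>x. w x *\<^sub>R \<Phi> x) has_vector_derivative
          (meval (V0 \<alpha> \<beta> v) x ** W x - Wt x ** conj_transpose (meval (N0 \<alpha> \<beta> v) x))) (at x)"
        by (simp add: W[OF x] Wt[OF x] w_def[symmetric] mm.scaleR_right mm.scaleR_left
            V0_mult_W_poly[OF nz] \<Phi>_def ct.diff scaleR_diff_right)
    qed (simp_all add: V1W)
    have "\<forall>\<^sub>F x in at_right (-1). x \<in> {-1<..<(1::real)}" "\<forall>\<^sub>F x in at_left 1. x \<in> {-1<..<(1::real)}"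
      by (auto intro: eventually_at_rightI[of _ 1] eventually_at_leftI[of "-1"])
    then show "((\<lambda>x. meval (V1 \<alpha> \<beta> v) x ** W x) \<longlongrightarrow> 0) (at_right (-1))"
      "((\<lambda>x. meval (V1 \<alpha> \<beta> v) x ** W x) \<longlongrightarrow> 0) (at_left 1)"
      using jacobi_weight_tendsto_0[of "\<alpha> + 1" "\<beta> + 1"] signs unfolding w_def[symmetric]
      by (auto intro: lim)
  qed (use weight_W weight_Wt in simp_all)
qed

end
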